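(* Let $V:\mathbb{R}\to[0,\infty)$ be twice continuously differentiable, convex and even with $V(0)=0$, such that there exist $C_0,\alpha>0$ with $\lim_{\lambda\to 0^+}\sup_{|z|\le 1}\big|\lambda^{-1-\alpha}V'(\lambda z)-C_0|z|^{1+\alpha}\mathrm{sgn}(z)\big|=0$, and there exist $c_0,R_0\in(0,\infty)$, $\beta\in(-1,\infty)$ with $V'(z)\ge c_0z^{1+\beta}$ for all $z\ge R_0$. For $\varepsilon\in(0,1]$ and $x\in\mathbb{R}$ let $X^\varepsilon(x)$ be the unique strong solution of $dX^\varepsilon_t=-V'(X^\varepsilon_t)dt+\sqrt{\varepsilon}\,dB_t$, $X^\varepsilon_0=x$, let $\mu^\varepsilon$ be its unique invariant probability measure, and put $d^\varepsilon_t(x):=d_{\mathrm{TV}}(X^\varepsilon_t(x),\mu^\varepsilon)$. Let $x\in\mathbb{R}$ be given and assume that the scale $(a_\varepsilon=a_\varepsilon(x),\varepsilon\in(0,1])$ of positive numbers satisfies: (i) $\lim_{\varepsilon\to0}a_\varepsilon=\infty$; (ii) for any $t>0$, $\ 0<\liminf_{\varepsilon\to0}d^\varepsilon_{a_\varepsilon t}(x)\le\limsup_{\varepsilon\to0}d^\varepsilon_{a_\varepsilon t}(x)<1$. Then there is no cut-off for the family $(X^\varepsilon(x),\varepsilon\in(0,1])$ as $\varepsilon\to0$. In addition, if for every $t>0$ the limit $\lim_{\varepsilon\to0}d^\varepsilon_{a_\varepsilon t}(x)=G_x(t)\in(0,1)$ exists and the map $t\mapsto G_x(t)$ is continuous and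 strictly decreasing, then for any $\eta\in(0,1)$ $$\lim_{\varepsilon\to0}\frac{\tau^{\varepsilon,x}_{\mathsf{mix}}(\eta)}{a_\varepsilon}=\inf\{t>0:\ G_x(t)\le\eta\}.$$
   Context: $B$ is a standard one-dimensional Brownian motion; $\mathrm{sgn}(z)=z/|z|$ for $z\neq 0$, $\mathrm{sgn}(0)=0$. $d_{\mathrm{TV}}(\nu_1,\nu_2)=\sup_F|\nu_1(F)-\nu_2(F)|$ over measurable sets $F$; a random variable as argument stands for its law. The $\eta$-mixing time is $\tau^{\varepsilon,x}_{\mathsf{mix}}(\eta):=\inf\{t\ge0:d^\varepsilon_t(x)\le\eta\}$. Cut-off: a family $(X^\varepsilon,\varepsilon\in(0,1])$ of processes with unique invariant probability measures $\mu^\varepsilon$ exhibits cut-off if there are deterministic $t_\varepsilon>0$ with $t_\varepsilon\to\infty$ as $\varepsilon\to0$ such that $\lim_{\varepsilon\to0}d_{\mathrm{TV}}(X^\varepsilon_{\delta t_\varepsilon},\mu^\varepsilon)$ equals $1$ for every $\delta\in(0,1)$ and $0$ for every $\delta\in(1,\infty)$. "No cut-off" means that no such scale $(t_\varepsilon)$ exists. The infimum of the empty set is $+\infty$, and limits are taken in $[0,\infty]$. *)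

theory Defs
  imports "HOL-Probability.Probability"
begin

definition twice_cont_differentiable :: "(real \<Rightarrow> real) \<Rightarrow> bool" where
  "twice_cont_differentiable V \<longleftrightarrow>
     V differentiable_on UNIV \<and> deriv V differentiable_on UNIV \<and>
     continuous_on UNIV (deriv (deriv V))"

text \<open>Processes are functions \<open>X t \<omega>\<close> of a real time \<open>t\<close>; only the times \<open>t \<ge> 0\<close> matter.\<close>

definition brownian_motion :: "'a measure \<Rightarrow> (real \<Rightarrow> 'a \<Rightarrow> real) \<Rightarrow> bool" where
  "brownian_motion M B \<longleftrightarrow>
     prob_space M \<and>
     (\<forall>t\<ge>0. B t \<in> borel_measurable M) \<and>
     (AE \<omega> in M. B 0 \<omega> = 0) \<and>
     (AE \<omega> in M. continuous_on {0..} (\<lambda>t. B t \<omega>)) \<and>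
     (\<forall>s t. 0 \<le> s \<and> s < t \<longrightarrow>
        distributed M lborel (\<lambda>\<omega>. B t \<omega> - B s \<omega>) (normal_density 0 (sqrt (t - s)))) \<and>
     (\<forall>(n::nat) (t::nat \<Rightarrow> real). 0 \<le> t 0 \<and> incseq t \<longrightarrow>
        prob_space.indep_vars M (\<lambda>_. borel) (\<lambda>i \<omega>. B (t (Suc i)) \<omega> - B (t i) \<omega>) {..<n})"

text \<open>The sigma-algebra generated by \<open>B\<close> up to time \<open>t\<close> and the null sets of \<open>M\<close>.\<close>

definition augmented_filtration ::
    "'a measure \<Rightarrow> (real \<Rightarrow> 'a \<Rightarrow> real) \<Rightarrow> real \<Rightarrow> 'a measure" where
  "augmented_filtration M B t =
     sigma (space M)
       ({B s -` A \<inter> space M | s A. 0 \<le> s \<and> s \<le> t \<and> A \<in> sets borel} \<union> null_sets M)"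

text \<open>Strong solution of \<open>dX = b(X) dt + \<sigma> dB\<close>, \<open>X\<^sub>0 = x\<close>.  The noise coefficient is constant, so
  the stochastic integral of \<open>\<sigma>\<close> up to time \<open>t\<close> is \<open>\<sigma> * B t\<close>.\<close>

definition strong_solution ::
    "'a measure \<Rightarrow> (real \<Rightarrow> 'a \<Rightarrow> real) \<Rightarrow> (real \<Rightarrow> real) \<Rightarrow> real \<Rightarrow> real \<Rightarrow>
     (real \<Rightarrow> 'a \<Rightarrow> real) \<Rightarrow> bool" where
  "strong_solution M B b \<sigma> x X \<longleftrightarrow>
     (\<forall>t\<ge>0. X t \<in> borel_measurable (augmented_filtration M B t)) \<and>
     (AE \<omega> in M. X 0 \<omega> = x \<and> continuous_on {0..} (\<lambda>t. X t \<omega>) \<and>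
        (\<forall>t\<ge>0. X t \<omega> = x + integral {0..t} (\<lambda>s. b (X s \<omega>)) + \<sigma> * B t \<omega>))"

text \<open>Here \<open>Y y\<close> is the process started at \<open>y\<close>, so that \<open>distr M borel (Y y t)\<close> is the
  time-\<open>t\<close> transition probability from \<open>y\<close>.\<close>

definition invariant_prob ::
    "'a measure \<Rightarrow> (real \<Rightarrow> real \<Rightarrow> 'a \<Rightarrow> real) \<Rightarrow> real measure \<Rightarrow> bool" where
  "invariant_prob M Y \<mu> \<longleftrightarrow>
     prob_space \<mu> \<and> sets \<mu> = sets borel \<and>
     (\<forall>t\<ge>0. \<forall>A\<in>sets borel. (\<integral>\<^sup>+ y. emeasure (distr M borel (Y y t)) A \<partial>\<mu>) = emeasure \<mu> A)"

definition tv_dist :: "'b measure \<Rightarrow> 'b measure \<Rightarrow> real" where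
  "tv_dist \<nu>\<^sub>1 \<nu>\<^sub>2 = (SUP F\<in>sets \<nu>\<^sub>1. \<bar>measure \<nu>\<^sub>1 F - measure \<nu>\<^sub>2 F\<bar>)"

definition tv_to :: "'a measure \<Rightarrow> (real \<Rightarrow> 'a \<Rightarrow> real) \<Rightarrow> real measure \<Rightarrow> real \<Rightarrow> real" where
  "tv_to M X \<mu> t = tv_dist (distr M borel (X t)) \<mu>"

definition cutoff ::
    "'a measure \<Rightarrow> (real \<Rightarrow> real \<Rightarrow> 'a \<Rightarrow> real) \<Rightarrow> (real \<Rightarrow> real measure) \<Rightarrow> bool" where
  "cutoff M X \<mu> \<longleftrightarrow>
     (\<exists>T::real \<Rightarrow> real.
        (\<forall>\<epsilon>\<in>{0<..1}. 0 < T \<epsilon>) \<and>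
        filterlim T at_top (at_right 0) \<and>
        (\<forall>\<delta>\<in>{0<..<1}. ((\<lambda>\<epsilon>. tv_to M (X \<epsilon>) (\<mu> \<epsilon>) (\<delta> * T \<epsilon>)) \<longlongrightarrow> 1) (at_right 0)) \<and>
        (\<forall>\<delta>\<in>{1<..}. ((\<lambda>\<epsilon>. tv_to M (X \<epsilon>) (\<mu> \<epsilon>) (\<delta> * T \<epsilon>)) \<longlongrightarrow> 0) (at_right 0)))"

text \<open>Extended real, so that the infimum of the empty set is \<open>\<infinity>\<close>.\<close>

definition mixing_time :: "(real \<Rightarrow> real) \<Rightarrow> real \<Rightarrow> ereal" where
  "mixing_time d \<eta> = Inf {ereal t | t. 0 \<le> t \<and> d t \<le> \<eta>}"

end

theory Submission
  imports Defs
begin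

text \<open>
  Everything rests on the fact that \<open>d t\<close>, the total variation distance to equilibrium, is
  nonincreasing in \<open>t\<close>. If \<open>T\<close> were a cut-off scale, comparing \<open>d (2 * T) \<rightarrow> 0\<close> with the lower bound
  for \<open>d (4 * a)\<close> and \<open>d (T / 2) \<rightarrow> 1\<close> with the upper bound for \<open>d a\<close> would give
  \<open>4 * a < 2 * T < 4 * a\<close>. Likewise, monotonicity squeezes the mixing time between \<open>a * t\<close>
  and \<open>a * t'\<close> whenever \<open>G t > \<eta> > G t'\<close>.

  Monotonicity follows from the Markov property together with the fact that Markov kernels contract total
  variation. To obtain the Markov property from the pathwise equation, the solution is approximated by
  the backward Euler scheme \<open>Y (k + 1) = (id + h V')\<^sup>-\<^sup>1 (Y k + \<Delta>W)\<close>. As \<open>V'\<close> is nondecreasing, the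
  resolvent \<open>(id + h V')\<^sup>-\<^sup>1\<close> is nonexpansive, so the scheme converges pathwise with an error controlled by the
  modulus of continuity of \<open>V'\<close> along the path, without localization, and it preserves Lipschitz
  constants. Its Markov property is a finite-dimensional consequence of independent increments.
\<close>

subsection \<open>The backward Euler scheme\<close>

locale monotone_function =
  fixes g :: "real \<Rightarrow> real"
  assumes cont_g: "continuous_on UNIV g" and mono_g: "mono g"
begin

text \<open>This is the inverse of \<open>id + h g\<close>. The description is meaningful for
  \<open>0 \<le> h\<close>, where \<open>resolvent_exists\<close> and
  \<open>resolvent_expand\<close> give existence and uniqueness.\<close>

definition resolvent :: "real \<Rightarrow> real \<Rightarrow> real" where
  "resolvent h z = (THE y. y + h * g y = z)"

text \<open>For \<open>u \<le> v\<close> the term \<open>h * (g v - g u)\<close> is nonnegative and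
  can only enlarge the difference. Uniqueness and nonexpansiveness of the resolvent both come from
  this.\<close>

lemma resolvent_expand:
  assumes "0 \<le> h"
  shows "\<bar>y - y'\<bar> \<le> \<bar>(y + h * g y) - (y' + h * g y')\<bar>"
proof -
  have *: "v - u \<le> (v + h * g v) - (u + h * g u)" if "u \<le> v" for u v
    using mult_left_mono[OF monoD[OF mono_g that] assms] by simp
  show ?thesis
    using *[of y y'] *[of y' y] by (cases "y \<le> y'") auto
qed

lemma resolvent_exists:
  assumes h: "0 \<le> h"
  shows "\<exists>y. y + h * g y = z"
proof -
  \<comment> \<open>\<open>K\<close> solves the equation with \<open>g\<close> frozen at
    \<open>0\<close>. The map equals \<open>z - K\<close> at \<open>0\<close> and
    \<open>z + h * (g K - g 0)\<close> at \<open>K\<close>, so monotonicity places \<open>z\<close>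
    between these two values.\<close>
  define K where "K = z - h * g 0"
  have cont: "continuous_on {u..v} (\<lambda>y. y + h * g y)" for u v
    by (intro continuous_intros continuous_on_subset[OF cont_g]) auto
  show ?thesis
  proof (cases "0 \<le> K")
    case True
    then have "h * g 0 \<le> h * g K"
      using h monoD[OF mono_g] by (intro mult_left_mono) auto
    then have "\<exists>y\<ge>0. y \<le> K \<and> y + h * g y = z"
      using True by (intro IVT' cont) (auto simp: K_def)
    then show ?thesis by blast
  next
    case False
    then have "h * g K \<le> h * g 0"
      using h monoD[OF mono_g] by (intro mult_left_mono) auto
    then have "\<exists>y\<ge>K. y \<le> 0 \<and> y + h * g y = z"
      using False by (intro IVT' cont) (auto simp: K_def)
    then show ?thesis by blast
  qed
qed

lemma resolvent_eq:
  assumes "0 \<le> h"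
  shows "resolvent h (y + h * g y) = y"
  unfolding resolvent_def
proof (rule the_equality)
  fix y' assume "y' + h * g y' = y + h * g y"
  then show "y' = y"
    using resolvent_expand[OF assms, of y' y] by simp
qed simp

lemma resolvent_nonexpansive:
  assumes "0 \<le> h"
  shows "\<bar>resolvent h z - resolvent h z'\<bar> \<le> \<bar>z - z'\<bar>"
  by (metis resolvent_eq[OF assms] resolvent_exists[OF assms] resolvent_expand[OF assms])

lemma resolvent_measurable [measurable]:
  assumes "0 \<le> h"
  shows "resolvent h \<in> borel_measurable borel"
proof -
  have "1-lipschitz_on UNIV (resolvent h)"
    using resolvent_nonexpansive[OF assms] by (intro lipschitz_onI) (auto simp: dist_real_def)
  then show ?thesis
    by (intro borel_measurable_continuous_onI lipschitz_on_continuous_on)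
qed

section \<open>The implicit Euler recursion and its pathwise error\<close>

primrec backward_euler :: "(nat \<Rightarrow> real) \<Rightarrow> (nat \<Rightarrow> real) \<Rightarrow> real \<Rightarrow> nat \<Rightarrow> real" where
  "backward_euler h d y 0 = y"
| "backward_euler h d y (Suc k) = resolvent (h k) (backward_euler h d y k + d k)"

lemma backward_euler_cong:
  assumes "\<And>i. i < k \<Longrightarrow> d i = d' i"
  shows "backward_euler h d y k = backward_euler h d' y k"
  using assms by (induction k) auto

lemma backward_euler_measurable:
  assumes "\<And>k. 0 \<le> h k" and "\<And>i. i < k \<Longrightarrow> (\<lambda>\<omega>. d \<omega> i) \<in> borel_measurable N"
  shows "(\<lambda>\<omega>. backward_euler h (d \<omega>) y k) \<in> borel_measurable N"
  using assms(2)
proof (induction k)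
  case (Suc k)
  then have "(\<lambda>\<omega>. backward_euler h (d \<omega>) y k + d \<omega> k) \<in> borel_measurable N"
    by (intro borel_measurable_add) auto
  then show ?case
    using measurable_compose[OF _ resolvent_measurable[OF assms(1)]] by simp
qed simp

text \<open>The exact value \<open>u q\<close> is the resolvent of
  \<open>u q + (q - p) * g (u q)\<close>. By the integral equation this argument differs from
  \<open>y + d\<close> by \<open>u p - y\<close> plus the integral of
  \<open>g (u q) - g (u r)\<close>, and the resolvent does not amplify the difference.\<close>

lemma resolvent_step_error:
  assumes "p \<le> q" and contu: "continuous_on {p..q} u"
    and eq: "u q = u p - integral {p..q} (\<lambda>r. g (u r)) + d"
    and osc: "\<And>r. r \<in> {p..q} \<Longrightarrow> \<bar>g (u q) - g (u r)\<bar> \<le> e"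
  shows "\<bar>u q - resolvent (q - p) (y + d)\<bar> \<le> \<bar>u p - y\<bar> + (q - p) * e"
proof -
  have contgu: "continuous_on {p..q} (\<lambda>r. g (u r))"
    using continuous_on_compose2[OF cont_g contu] by simp
  have int: "(\<lambda>r. g (u r)) integrable_on {p..q}"
    by (rule integrable_continuous_interval[OF contgu])
  have int': "(\<lambda>r. g (u q) - g (u r)) integrable_on {p..q}"
    by (intro integrable_continuous_interval continuous_intros contgu)
  have "u q = resolvent (q - p) (u q + (q - p) * g (u q))"
    using assms(1) by (simp add: resolvent_eq)
  then have "\<bar>u q - resolvent (q - p) (y + d)\<bar> \<le> \<bar>(u q + (q - p) * g (u q)) - (y + d)\<bar>"
    using resolvent_nonexpansive[of "q - p"] assms(1) by (metis diff_ge_0_iff_ge)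
  also have "(u q + (q - p) * g (u q)) - (y + d) =
      (u p - y) + integral {p..q} (\<lambda>r. g (u q) - g (u r))"
    using assms(1) int eq by (subst Henstock_Kurzweil_Integration.integral_diff) auto
  also have "\<bar>\<dots>\<bar> \<le> \<bar>u p - y\<bar> + \<bar>integral {p..q} (\<lambda>r. g (u q) - g (u r))\<bar>"
    by (rule abs_triangle_ineq)
  also have "\<bar>integral {p..q} (\<lambda>r. g (u q) - g (u r))\<bar> \<le> integral {p..q} (\<lambda>r. e)"
    using integral_norm_bound_integral[OF int' integrable_const_ivl, of e] osc
    unfolding real_norm_def by blast
  also have "integral {p..q} (\<lambda>r. e) = (q - p) * e"
    using assms(1) by simp
  finally show ?thesis by simp
qed

text \<open>Each step passes the inherited error on with factor one, so the local errors merely add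
  up.\<close>

lemma backward_euler_error:
  assumes "incseq \<tau>" and contu: "continuous_on {\<tau> 0..\<tau> n} u"
    and eq: "\<And>k. k < n \<Longrightarrow>
      u (\<tau> (Suc k)) = u (\<tau> k) - integral {\<tau> k..\<tau> (Suc k)} (\<lambda>r. g (u r)) + d k"
    and osc: "\<And>k r. k < n \<Longrightarrow> r \<in> {\<tau> k..\<tau> (Suc k)} \<Longrightarrow> \<bar>g (u (\<tau> (Suc k))) - g (u r)\<bar> \<le> e"
    and "k \<le> n"
  shows "\<bar>u (\<tau> k) - backward_euler (\<lambda>k. \<tau> (Suc k) - \<tau> k) d (u (\<tau> 0)) k\<bar> \<le> (\<tau> k - \<tau> 0) * e"
  using \<open>k \<le> n\<close>
proof (induction k)
  case (Suc k)
  let ?E = "backward_euler (\<lambda>k. \<tau> (Suc k) - \<tau> k) d (u (\<tau> 0))"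
  have "{\<tau> k..\<tau> (Suc k)} \<subseteq> {\<tau> 0..\<tau> n}"
    using incseqD[OF \<open>incseq \<tau>\<close>, of 0 k] incseqD[OF \<open>incseq \<tau>\<close> Suc.prems] by auto
  then have "continuous_on {\<tau> k..\<tau> (Suc k)} u"
    by (rule continuous_on_subset[OF contu])
  then have "\<bar>u (\<tau> (Suc k)) - ?E (Suc k)\<bar> \<le> \<bar>u (\<tau> k) - ?E k\<bar> + (\<tau> (Suc k) - \<tau> k) * e"
    using Suc.prems incseqD[OF \<open>incseq \<tau>\<close>, of k "Suc k"]
    unfolding backward_euler.simps by (intro resolvent_step_error eq osc) auto
  with Suc show ?case by (simp add: algebra_simps)
qed simp

text \<open>By uniform continuity of \<open>g (u r)\<close> on \<open>[0, T]\<close>, its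
  oscillation over one grid interval vanishes with the mesh. The free index \<open>k N\<close>
  serves an intermediate grid point as well as the final one.\<close>

lemma backward_euler_converges:
  assumes contu: "continuous_on {0..T} u"
    and eq: "\<And>p q. 0 \<le> p \<Longrightarrow> p \<le> q \<Longrightarrow> q \<le> T \<Longrightarrow>
      u q = u p - integral {p..q} (\<lambda>r. g (u r)) + (w q - w p)"
    and \<tau>: "\<And>N. incseq (\<tau> N)" "\<And>N. \<tau> N 0 = 0" "\<And>N. \<tau> N (m N) = T"
    and mesh: "\<And>N k. k < m N \<Longrightarrow> \<tau> N (Suc k) - \<tau> N k \<le> \<delta> N" "\<delta> \<longlonglongrightarrow> 0"
    and k: "\<And>N. k N \<le> m N"
  shows "(\<lambda>N. u (\<tau> N (k N)) - backward_euler (\<lambda>i. \<tau> N (Suc i) - \<tau> N i)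
      (\<lambda>i. w (\<tau> N (Suc i)) - w (\<tau> N i)) (u 0) (k N)) \<longlonglongrightarrow> 0"
proof (rule LIMSEQ_I)
  fix e :: real assume "0 < e"
  have range: "0 \<le> \<tau> N i" "i \<le> m N \<Longrightarrow> \<tau> N i \<le> T" for N i
    using incseqD[OF \<tau>(1)[of N], of 0 i] incseqD[OF \<tau>(1)[of N], of i "m N"] \<tau>(2,3) by auto
  have T: "0 \<le> T" using range(1)[of 0 "m 0"] \<tau>(3) by simp
  \<comment> \<open>\<open>T + 1\<close> keeps the denominator positive when \<open>T = 0\<close>;
    the accumulated error will be at most \<open>T * e'\<close>.\<close>
  define e' where "e' = e / (2 * (T + 1))"
  have e': "0 < e'" "T * e' < e"
    using \<open>0 < e\<close> T by (auto simp: e'_def field_simps intro: add_nonneg_pos)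
  have "uniformly_continuous_on {0..T} (\<lambda>r. g (u r))"
    by (intro compact_uniformly_continuous continuous_on_compose2[OF cont_g contu]) auto
  then obtain \<rho> where "0 < \<rho>" and \<rho>: "\<And>p q. p \<in> {0..T} \<Longrightarrow> q \<in> {0..T} \<Longrightarrow> \<bar>p - q\<bar> < \<rho> \<Longrightarrow>
      \<bar>g (u p) - g (u q)\<bar> < e'"
    using e' unfolding uniformly_continuous_on_def dist_real_def by metis
  obtain N0 where N0: "\<And>N. N0 \<le> N \<Longrightarrow> \<delta> N < \<rho>"
    using order_tendstoD(2)[OF mesh(2) \<open>0 < \<rho>\<close>] by (auto simp: eventually_sequentially)
  have "\<bar>u (\<tau> N (k N)) - backward_euler (\<lambda>i. \<tau> N (Suc i) - \<tau> N i)
      (\<lambda>i. w (\<tau> N (Suc i)) - w (\<tau> N i)) (u (\<tau> N 0)) (k N)\<bar> \<le> (\<tau> N (k N) - \<tau> N 0) * e'"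
    if "N0 \<le> N" for N
  proof (rule backward_euler_error[OF \<tau>(1) _ _ _ k])
    show "continuous_on {\<tau> N 0..\<tau> N (m N)} u"
      using contu by (simp add: \<tau>)
    fix i assume i: "i < m N"
    show "u (\<tau> N (Suc i)) = u (\<tau> N i) - integral {\<tau> N i..\<tau> N (Suc i)} (\<lambda>r. g (u r)) +
        (w (\<tau> N (Suc i)) - w (\<tau> N i))"
      using i range incseqD[OF \<tau>(1)[of N], of i "Suc i"] by (intro eq) auto
    fix r assume "r \<in> {\<tau> N i..\<tau> N (Suc i)}"
    then show "\<bar>g (u (\<tau> N (Suc i))) - g (u r)\<bar> \<le> e'"
      using i range(1)[of N i] range(2)[of "Suc i" N] mesh(1)[OF i] N0[OF that]
      by (intro less_imp_le \<rho>) auto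
  qed
  moreover have "(\<tau> N (k N) - \<tau> N 0) * e' \<le> T * e'" for N
    using e'(1) range(2)[OF k[of N]] \<tau>(2) by (intro mult_right_mono) auto
  ultimately show "\<exists>N0. \<forall>N\<ge>N0. norm (u (\<tau> N (k N)) - backward_euler (\<lambda>i. \<tau> N (Suc i) - \<tau> N i)
      (\<lambda>i. w (\<tau> N (Suc i)) - w (\<tau> N i)) (u 0) (k N) - 0) < e"
    using e'(2) unfolding \<tau>(2) diff_0_right real_norm_def by (meson le_less_trans)
qed

end

subsection \<open>The Markov property\<close>

text \<open>Each Euler step keeps this class with unchanged \<open>C\<close> and \<open>L\<close>.
  Both constants are parameters so that bounds are uniform in the number of steps and survive
  pointwise limits.\<close>

definition bounded_lipschitz :: "real \<Rightarrow> real \<Rightarrow> (real \<Rightarrow> real) \<Rightarrow> bool" where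
  "bounded_lipschitz C L f \<longleftrightarrow> (\<forall>y. \<bar>f y\<bar> \<le> C) \<and> (\<forall>y z. \<bar>f y - f z\<bar> \<le> L * \<bar>y - z\<bar>)"

lemma bounded_lipschitz_measurable:
  assumes "bounded_lipschitz C L f"
  shows "f \<in> borel_measurable borel"
proof -
  have "\<bar>f y - f z\<bar> \<le> \<bar>L\<bar> * \<bar>y - z\<bar>" for y z
  proof -
    have "\<bar>f y - f z\<bar> \<le> L * \<bar>y - z\<bar>"
      using assms by (simp add: bounded_lipschitz_def)
    also have "\<dots> \<le> \<bar>L\<bar> * \<bar>y - z\<bar>"
      by (intro mult_right_mono) auto
    finally show ?thesis .
  qed
  then have "\<bar>L\<bar>-lipschitz_on UNIV f"
    by (intro lipschitz_onI) (auto simp: dist_real_def)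
  then show ?thesis
    by (intro borel_measurable_continuous_onI lipschitz_on_continuous_on)
qed

lemma bounded_lipschitz_cts_step:
  assumes "a < b"
  shows "bounded_lipschitz 1 (1 / (b - a)) (cts_step a b)"
proof -
  \<comment> \<open>The ramp is an affine map clamped to \<open>[0, 1]\<close>, and clamping is
    nonexpansive.\<close>
  have eq: "cts_step a b y = max 0 (min 1 ((b - y) / (b - a)))" for y
    using assms by (auto simp: cts_step_def field_simps max_def min_def)
  have clamp: "\<bar>max 0 (min 1 p) - max 0 (min 1 q)\<bar> \<le> \<bar>p - q\<bar>" for p q :: real
    by (auto simp: max_def min_def)
  have "\<bar>cts_step a b y - cts_step a b z\<bar> \<le> 1 / (b - a) * \<bar>y - z\<bar>" for y z
  proof -
    have "\<bar>cts_step a b y - cts_step a b z\<bar> \<le> \<bar>(b - y) / (b - a) - (b - z) / (b - a)\<bar>"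
      unfolding eq by (rule clamp)
    also have "\<dots> = 1 / (b - a) * \<bar>y - z\<bar>"
      using assms by (simp add: diff_divide_distrib[symmetric] abs_divide abs_minus_commute)
    finally show ?thesis .
  qed
  then show ?thesis
    by (simp add: bounded_lipschitz_def eq)
qed

text \<open>The ramps descend just to the right of \<open>c\<close>, so the limit keeps the value
  one at \<open>c\<close> itself. They link Lipschitz test functions to distribution
  functions.\<close>

lemma cts_step_tendsto:
  "(\<lambda>n. cts_step c (c + 1 / real (Suc n)) z) \<longlonglongrightarrow> indicator {..c} (z :: real)"
proof (cases "z \<le> c")
  case False
  then have "\<forall>\<^sub>F n in sequentially. c + 1 / real (Suc n) < z"
    using LIMSEQ_inverse_real_of_nat_add[of c]
    by (intro order_tendstoD(2)[of _ c]) (auto simp: inverse_eq_divide)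
  then have "\<forall>\<^sub>F n in sequentially. cts_step c (c + 1 / real (Suc n)) z = indicator {..c} z"
    by (rule eventually_mono) (use False in \<open>auto simp: cts_step_def\<close>)
  then show ?thesis by (rule tendsto_eventually)
qed (simp add: cts_step_def)

lemma bounded_lipschitz_cts_step_Suc:
  "bounded_lipschitz 1 (real (Suc n)) (cts_step c (c + 1 / real (Suc n)))"
  using bounded_lipschitz_cts_step[of c "c + 1 / real (Suc n)"] by simp

section \<open>The equation with monotone drift and its Euler chain\<close>

locale monotone_sde = prob_space M + monotone_function g
  for M :: "'a measure" and g +
  fixes B :: "real \<Rightarrow> 'a \<Rightarrow> real" and \<sigma> :: real and X :: "real \<Rightarrow> real \<Rightarrow> 'a \<Rightarrow> real"
  assumes B_measurable: "\<And>t. 0 \<le> t \<Longrightarrow> B t \<in> borel_measurable M"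
    and B_increment: "\<And>t h. 0 \<le> t \<Longrightarrow> 0 < h \<Longrightarrow>
      distr M borel (\<lambda>\<omega>. B (t + h) \<omega> - B t \<omega>) = density lborel (normal_density 0 (sqrt h))"
    and B_indep: "\<And>n (\<tau> :: nat \<Rightarrow> real). 0 \<le> \<tau> 0 \<Longrightarrow> incseq \<tau> \<Longrightarrow>
      indep_vars (\<lambda>_. borel) (\<lambda>i \<omega>. B (\<tau> (Suc i)) \<omega> - B (\<tau> i) \<omega>) {..<n}"
    and X_measurable: "\<And>t y. 0 \<le> t \<Longrightarrow> X y t \<in> borel_measurable M"
    and X_solution: "\<And>y. AE \<omega> in M. X y 0 \<omega> = y \<and> continuous_on {0..} (\<lambda>t. X y t \<omega>) \<and>
      (\<forall>t\<ge>0. X y t \<omega> = y + integral {0..t} (\<lambda>s. - g (X y s \<omega>)) + \<sigma> * B t \<omega>)"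
begin

text \<open>The one-step transition operator of the Euler scheme, acting on test functions; its
  powers describe several steps of equal length.\<close>

definition euler_kernel :: "real \<Rightarrow> (real \<Rightarrow> real) \<Rightarrow> real \<Rightarrow> real" where
  "euler_kernel h f y =
     (\<integral>z. f (resolvent h (y + \<sigma> * z)) \<partial>density lborel (normal_density 0 (sqrt h)))"

text \<open>The noise is written through increments of \<open>\<sigma> * B\<close>, the form of
  \<open>w\<close> in \<open>backward_euler_converges\<close>.\<close>

definition euler_chain :: "(nat \<Rightarrow> real) \<Rightarrow> real \<Rightarrow> 'a \<Rightarrow> nat \<Rightarrow> real" where
  "euler_chain \<tau> y \<omega> = backward_euler (\<lambda>i. \<tau> (Suc i) - \<tau> i)
     (\<lambda>i. \<sigma> * B (\<tau> (Suc i)) \<omega> - \<sigma> * B (\<tau> i) \<omega>) y"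

text \<open>Steps from \<open>y\<close> and \<open>z\<close> driven by the same Gaussian value do
  not move apart, whatever that value is; averaging over it keeps the bound.\<close>

lemma bounded_lipschitz_euler_kernel:
  assumes "0 < h" and f: "bounded_lipschitz C L f" and "0 \<le> L"
  shows "bounded_lipschitz C L (euler_kernel h f)"
proof -
  interpret N: prob_space "density lborel (normal_density 0 (sqrt h))"
    using \<open>0 < h\<close> by (intro prob_space_normal_density) simp
  have bound: "\<bar>f y\<bar> \<le> C" and lip: "\<bar>f y - f z\<bar> \<le> L * \<bar>y - z\<bar>" for y z
    using f by (auto simp: bounded_lipschitz_def)
  note [measurable] = bounded_lipschitz_measurable[OF f] resolvent_measurable[OF less_imp_le[OF \<open>0 < h\<close>]]
  have int: "integrable (density lborel (normal_density 0 (sqrt h))) (\<lambda>z. f (resolvent h (y + \<sigma> * z)))"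
    for y
    by (rule N.integrable_const_bound[where B = C]) (auto simp: bound)
  have "\<bar>euler_kernel h f y\<bar> \<le> C" for y
    unfolding euler_kernel_def
    by (rule order_trans[OF integral_abs_bound N.integral_le_const]) (auto simp: bound int)
  moreover have "\<bar>euler_kernel h f y - euler_kernel h f z\<bar> \<le> L * \<bar>y - z\<bar>" for y z
  proof -
    have "\<bar>f (resolvent h (y + \<sigma> * u)) - f (resolvent h (z + \<sigma> * u))\<bar> \<le> L * \<bar>y - z\<bar>" for u
      using \<open>0 < h\<close> resolvent_nonexpansive[of h "y + \<sigma> * u" "z + \<sigma> * u"]
      by (intro order_trans[OF lip] mult_left_mono \<open>0 \<le> L\<close>) auto
    then show ?thesis
      unfolding euler_kernel_def Bochner_Integration.integral_diff[OF int int, symmetric]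
      by (intro order_trans[OF integral_abs_bound N.integral_le_const]) (auto simp: int)
  qed
  ultimately show ?thesis by (simp add: bounded_lipschitz_def)
qed

lemma bounded_lipschitz_euler_kernel_pow:
  assumes "0 < h" "bounded_lipschitz C L f" "0 \<le> L"
  shows "bounded_lipschitz C L ((euler_kernel h ^^ m) f)"
  using assms by (induction m) (auto intro: bounded_lipschitz_euler_kernel)

text \<open>Independence makes the joint law of \<open>Y\<close> and \<open>\<xi>\<close> a product,
  and Fubini integrates out the Gaussian increment first.\<close>

lemma expectation_euler_step:
  assumes "0 < h" and f: "bounded_lipschitz C L f" and "0 \<le> L"
    and indep: "indep_var borel Y borel \<xi>"
    and law: "distr M borel \<xi> = density lborel (normal_density 0 (sqrt h))"
  shows "expectation (\<lambda>\<omega>. f (resolvent h (Y \<omega> + \<sigma> * \<xi> \<omega>))) = expectation (\<lambda>\<omega>. euler_kernel h f (Y \<omega>))"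
proof -
  have [measurable]: "Y \<in> borel_measurable M" "\<xi> \<in> borel_measurable M"
    using indep by (auto dest: indep_var_rv1 indep_var_rv2)
  note [measurable] = bounded_lipschitz_measurable[OF f] resolvent_measurable[OF less_imp_le[OF \<open>0 < h\<close>]]
  define F where "F p = f (resolvent h (fst p + \<sigma> * snd p))" for p
  have [measurable]: "F \<in> borel_measurable (borel \<Otimes>\<^sub>M borel)"
    unfolding F_def[abs_def] by measurable
  interpret Y: prob_space "distr M borel Y" by (rule prob_space_distr) simp
  interpret \<xi>: prob_space "distr M borel \<xi>" by (rule prob_space_distr) simp
  interpret P: pair_prob_space "distr M borel Y" "distr M borel \<xi>" ..
  have int: "integrable (distr M borel Y \<Otimes>\<^sub>M distr M borel \<xi>) F"
    using f by (intro P.integrable_const_bound[where B = C]) (auto simp: F_def bounded_lipschitz_def)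
  have [measurable]: "euler_kernel h f \<in> borel_measurable borel"
    by (rule bounded_lipschitz_measurable[OF bounded_lipschitz_euler_kernel[OF \<open>0 < h\<close> f \<open>0 \<le> L\<close>]])
  have "expectation (\<lambda>\<omega>. F (Y \<omega>, \<xi> \<omega>)) = integral\<^sup>L (distr M (borel \<Otimes>\<^sub>M borel) (\<lambda>\<omega>. (Y \<omega>, \<xi> \<omega>))) F"
    by (subst integral_distr) auto
  also have "distr M (borel \<Otimes>\<^sub>M borel) (\<lambda>\<omega>. (Y \<omega>, \<xi> \<omega>)) = distr M borel Y \<Otimes>\<^sub>M distr M borel \<xi>"
    using indep by (simp add: indep_var_distribution_eq)
  also have "integral\<^sup>L \<dots> F = (\<integral>y. euler_kernel h f y \<partial>distr M borel Y)"
    by (subst P.integral_fst'[OF int, symmetric]) (simp add: law F_def euler_kernel_def[abs_def])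
  also have "\<dots> = expectation (\<lambda>\<omega>. euler_kernel h f (Y \<omega>))"
    by (subst integral_distr) auto
  finally show ?thesis by (simp add: F_def)
qed

lemma euler_chain_measurable:
  assumes "incseq \<tau>" "0 \<le> \<tau> 0"
  shows "(\<lambda>\<omega>. euler_chain \<tau> y \<omega> k) \<in> borel_measurable M"
proof -
  have "0 \<le> \<tau> i" for i
    using incseqD[OF assms(1), of 0 i] assms(2) by simp
  note [measurable] = B_measurable[OF this]
  show ?thesis
    using incseq_SucD[OF assms(1)] unfolding euler_chain_def
    by (intro backward_euler_measurable) auto
qed

text \<open>The first \<open>k\<close> steps read only the increments with index below
  \<open>k\<close>, and disjoint blocks of an independent family are independent.\<close>

lemma euler_chain_indep:
  assumes "incseq \<tau>" "0 \<le> \<tau> 0"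
  shows "indep_var borel (\<lambda>\<omega>. euler_chain \<tau> y \<omega> k) borel (\<lambda>\<omega>. B (\<tau> (Suc k)) \<omega> - B (\<tau> k) \<omega>)"
proof -
  let ?I = "\<lambda>i \<omega>. B (\<tau> (Suc i)) \<omega> - B (\<tau> i) \<omega>"
  let ?F = "\<lambda>d. backward_euler (\<lambda>i. \<tau> (Suc i) - \<tau> i) (\<lambda>i. \<sigma> * d i) y k"
  have "indep_var (PiM {..<k} (\<lambda>_. borel)) (\<lambda>\<omega>. restrict (\<lambda>i. ?I i \<omega>) {..<k})
      (PiM {k} (\<lambda>_. borel)) (\<lambda>\<omega>. restrict (\<lambda>i. ?I i \<omega>) {k})"
    by (rule indep_var_restrict[OF B_indep[OF assms(2,1), of "Suc k"]]) auto
  moreover have "?F \<in> borel_measurable (PiM {..<k} (\<lambda>_. borel))"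
    using incseq_SucD[OF assms(1)] by (intro backward_euler_measurable) auto
  moreover have "(\<lambda>d. d k) \<in> borel_measurable (PiM {k} (\<lambda>_. borel :: real measure))"
    by measurable
  ultimately have "indep_var borel (?F \<circ> (\<lambda>\<omega>. restrict (\<lambda>i. ?I i \<omega>) {..<k}))
      borel ((\<lambda>d. d k) \<circ> (\<lambda>\<omega>. restrict (\<lambda>i. ?I i \<omega>) {k}))"
    by (rule indep_var_compose)
  \<comment> \<open>\<open>restrict\<close> alters only coordinates with index at least
    \<open>k\<close>, which the first \<open>k\<close> steps do not read.\<close>
  moreover have "?F \<circ> (\<lambda>\<omega>. restrict (\<lambda>i. ?I i \<omega>) {..<k}) = (\<lambda>\<omega>. euler_chain \<tau> y \<omega> k)"
    unfolding euler_chain_def comp_def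
    by (intro ext backward_euler_cong) (simp add: right_diff_distrib)
  ultimately show ?thesis by (simp add: comp_def)
qed

text \<open>The Markov property of the chain. The last step is peeled off and turned into a kernel
  applied to \<open>f\<close>, so the induction generalizes over \<open>f\<close>.\<close>

lemma expectation_euler_chain:
  assumes "incseq \<tau>" "0 \<le> \<tau> 0" "0 < h" "0 \<le> L"
    and "\<And>k. n \<le> k \<Longrightarrow> k < n + m \<Longrightarrow> \<tau> (Suc k) - \<tau> k = h"
    and "bounded_lipschitz C L f"
  shows "expectation (\<lambda>\<omega>. f (euler_chain \<tau> y \<omega> (n + m))) =
    expectation (\<lambda>\<omega>. (euler_kernel h ^^ m) f (euler_chain \<tau> y \<omega> n))"
  using assms(5,6)
proof (induction m arbitrary: f)
  case (Suc m)
  let ?k = "n + m"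
  have \<tau>: "\<tau> (Suc ?k) - \<tau> ?k = h" "\<tau> (Suc ?k) = \<tau> ?k + h"
    using Suc.prems(1)[of ?k] by auto
  have "0 \<le> \<tau> ?k"
    using incseqD[OF assms(1), of 0 ?k] assms(2) by simp
  have "expectation (\<lambda>\<omega>. f (euler_chain \<tau> y \<omega> (n + Suc m))) =
      expectation (\<lambda>\<omega>. f (resolvent h (euler_chain \<tau> y \<omega> ?k + \<sigma> * (B (\<tau> (Suc ?k)) \<omega> - B (\<tau> ?k) \<omega>))))"
    by (simp add: euler_chain_def \<tau>(1) right_diff_distrib)
  also have "\<dots> = expectation (\<lambda>\<omega>. euler_kernel h f (euler_chain \<tau> y \<omega> ?k))"
    using B_increment[OF \<open>0 \<le> \<tau> ?k\<close> \<open>0 < h\<close>]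
    by (intro expectation_euler_step[OF \<open>0 < h\<close> Suc.prems(2) \<open>0 \<le> L\<close>] euler_chain_indep assms) (simp add: \<tau>(2))
  also have "\<dots> = expectation (\<lambda>\<omega>. (euler_kernel h ^^ m) (euler_kernel h f) (euler_chain \<tau> y \<omega> n))"
    by (intro Suc.IH bounded_lipschitz_euler_kernel Suc.prems assms) auto
  finally show ?case by (simp add: funpow_swap1)
qed simp

text \<open>Subtracting the equations at \<open>q\<close> and \<open>p\<close> removes the initial
  value; a single null set serves all \<open>p\<close> and \<open>q\<close>.\<close>

lemma X_increment:
  "AE \<omega> in M. X y 0 \<omega> = y \<and> continuous_on {0..} (\<lambda>t. X y t \<omega>) \<and>
     (\<forall>p q. 0 \<le> p \<longrightarrow> p \<le> q \<longrightarrow>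
        X y q \<omega> = X y p \<omega> - integral {p..q} (\<lambda>r. g (X y r \<omega>)) + (\<sigma> * B q \<omega> - \<sigma> * B p \<omega>))"
  using X_solution[of y]
proof eventually_elim
  case (elim \<omega>)
  then have X0: "X y 0 \<omega> = y" and cont: "continuous_on {0..} (\<lambda>t. X y t \<omega>)"
    and sol: "\<And>t. 0 \<le> t \<Longrightarrow> X y t \<omega> = y + integral {0..t} (\<lambda>s. - g (X y s \<omega>)) + \<sigma> * B t \<omega>"
    by blast+
  have "continuous_on {0..q} (\<lambda>r. g (X y r \<omega>))" for q
    by (rule continuous_on_compose2[OF cont_g continuous_on_subset[OF cont]]) auto
  then have int: "(\<lambda>r. g (X y r \<omega>)) integrable_on {0..q}" for q
    by (rule integrable_continuous_interval)
  have "X y q \<omega> = X y p \<omega> - integral {p..q} (\<lambda>r. g (X y r \<omega>)) + (\<sigma> * B q \<omega> - \<sigma> * B p \<omega>)"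
    if "0 \<le> p" "p \<le> q" for p q
    using sol[of p] sol[of q] that Henstock_Kurzweil_Integration.integral_combine[OF that int]
    unfolding Henstock_Kurzweil_Integration.integral_neg by linarith
  with X0 cont show ?case by blast
qed

end

text \<open>The first \<open>n\<close> steps cover \<open>[0, t]\<close>, the next \<open>n\<close> steps cover \<open>[t, t + s]\<close>; the truncated
  subtraction makes the second term vanish during the first phase.\<close>

definition two_phase_grid :: "real \<Rightarrow> real \<Rightarrow> nat \<Rightarrow> nat \<Rightarrow> real" where
  "two_phase_grid t s n k = real (min k n) * (t / real n) + real (k - n) * (s / real n)"

lemma two_phase_grid_simps:
  assumes "0 < n"
  shows "two_phase_grid t s n 0 = 0" "two_phase_grid t s n n = t"
    "two_phase_grid t s n (n + n) = t + s"
  using assms by (auto simp: two_phase_grid_def)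

lemma two_phase_grid_step:
  "two_phase_grid t s n (Suc k) - two_phase_grid t s n k = (if k < n then t else s) / real n"
proof (cases "k < n")
  case True
  then show ?thesis by (simp add: two_phase_grid_def algebra_simps add_divide_distrib)
next
  case False
  then show ?thesis by (simp add: two_phase_grid_def Suc_diff_le algebra_simps add_divide_distrib)
qed

lemma two_phase_grid_incseq:
  assumes "0 \<le> t" "0 \<le> s"
  shows "incseq (two_phase_grid t s n)"
proof (rule incseq_SucI)
  fix k
  have "0 \<le> two_phase_grid t s n (Suc k) - two_phase_grid t s n k"
    unfolding two_phase_grid_step using assms by simp
  then show "two_phase_grid t s n k \<le> two_phase_grid t s n (Suc k)" by simp
qed

text \<open>The test functions may change with \<open>n\<close>: the common constant
  \<open>L\<close> turns pathwise closeness of the arguments into closeness of the values, and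
  \<open>2 * C\<close> dominates.\<close>

lemma (in prob_space) expectation_bounded_lipschitz_asymp:
  assumes F: "\<And>n. bounded_lipschitz C L (F n)"
    and [measurable]: "\<And>n. U n \<in> borel_measurable M" "\<And>n. W n \<in> borel_measurable M"
    and "AE \<omega> in M. (\<lambda>n. W n \<omega> - U n \<omega>) \<longlonglongrightarrow> 0"
  shows "(\<lambda>n. expectation (\<lambda>\<omega>. F n (W n \<omega>)) - expectation (\<lambda>\<omega>. F n (U n \<omega>))) \<longlonglongrightarrow> 0"
proof -
  note [measurable] = bounded_lipschitz_measurable[OF F]
  have bound: "\<bar>F n y\<bar> \<le> C" and lip: "\<bar>F n y - F n z\<bar> \<le> L * \<bar>y - z\<bar>" for n y z
    using F by (auto simp: bounded_lipschitz_def)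
  have diff_bound: "\<bar>F n y - F n z\<bar> \<le> 2 * C" for n y z
    using bound[of n y] bound[of n z] by linarith
  have "(\<lambda>n. expectation (\<lambda>\<omega>. F n (W n \<omega>) - F n (U n \<omega>))) \<longlonglongrightarrow> expectation (\<lambda>\<omega>. 0)"
  proof (rule integral_dominated_convergence[where w = "\<lambda>_. 2 * C"])
    show "AE \<omega> in M. (\<lambda>n. F n (W n \<omega>) - F n (U n \<omega>)) \<longlonglongrightarrow> 0"
      using assms(4)
    proof eventually_elim
      case (elim \<omega>)
      then have "(\<lambda>n. L * \<bar>W n \<omega> - U n \<omega>\<bar>) \<longlonglongrightarrow> 0"
        using tendsto_mult_right_zero[OF tendsto_rabs_zero] by blast
      then show ?case
        by (rule Lim_null_comparison[rotated]) (simp add: lip)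
    qed
    show "AE \<omega> in M. norm (F n (W n \<omega>) - F n (U n \<omega>)) \<le> 2 * C" for n
      unfolding real_norm_def by (intro AE_I2 diff_bound)
  qed auto
  moreover have "integrable M (\<lambda>\<omega>. F n (Y \<omega>))" if [measurable]: "Y \<in> borel_measurable M" for n Y
    by (rule integrable_const_bound[where B = C]) (auto simp: bound)
  ultimately show ?thesis by simp
qed

section \<open>Passing from the Euler chain to the solution\<close>

context monotone_sde
begin

text \<open>One chain on one grid approximates the solution at \<open>t\<close> and at
  \<open>t + s\<close>, so that the two times can be linked through the chain.\<close>

lemma euler_chain_converges:
  assumes "0 \<le> t" "0 \<le> s"
  shows "AE \<omega> in M. (\<lambda>N. X y t \<omega> - euler_chain (two_phase_grid t s (Suc N)) y \<omega> (Suc N)) \<longlonglongrightarrow> 0"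
    and "AE \<omega> in M. (\<lambda>N. X y (t + s) \<omega> - euler_chain (two_phase_grid t s (Suc N)) y \<omega> (Suc N + Suc N)) \<longlonglongrightarrow> 0"
proof -
  have conv: "AE \<omega> in M. (\<lambda>N. X y (two_phase_grid t s (Suc N) (k N)) \<omega> -
      euler_chain (two_phase_grid t s (Suc N)) y \<omega> (k N)) \<longlonglongrightarrow> 0"
    if k: "\<And>N. k N \<le> Suc N + Suc N" for k
    using X_increment[of y]
  proof eventually_elim
    case (elim \<omega>)
    then have X0: "X y 0 \<omega> = y" and cont: "continuous_on {0..} (\<lambda>t. X y t \<omega>)"
      and incr: "\<And>p q. 0 \<le> p \<Longrightarrow> p \<le> q \<Longrightarrow>
        X y q \<omega> = X y p \<omega> - integral {p..q} (\<lambda>r. g (X y r \<omega>)) + (\<sigma> * B q \<omega> - \<sigma> * B p \<omega>)"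
      by blast+
    show ?case
      \<comment> \<open>The convergence lemma starts the scheme at the initial value of the path, so
        \<open>y\<close> is rewritten as \<open>X y 0 \<omega>\<close> inside the scheme
        only.\<close>
      unfolding euler_chain_def X0[symmetric, THEN arg_cong[where f = "backward_euler _ _"]]
    proof (rule backward_euler_converges[where T = "t + s" and m = "\<lambda>N. Suc N + Suc N"
          and \<delta> = "\<lambda>N. (t + s) / real (Suc N)"])
      show "continuous_on {0..t + s} (\<lambda>t. X y t \<omega>)"
        by (rule continuous_on_subset[OF cont]) auto
      show "(\<lambda>N. (t + s) / real (Suc N)) \<longlonglongrightarrow> 0"
        using LIMSEQ_Suc[OF lim_const_over_n[of "t + s"]] by simp
      show "two_phase_grid t s (Suc N) (Suc k) - two_phase_grid t s (Suc N) k \<le> (t + s) / real (Suc N)"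
        for N k
        unfolding two_phase_grid_step using assms by (intro divide_right_mono) auto
      show "X y q \<omega> = X y p \<omega> - integral {p..q} (\<lambda>r. g (X y r \<omega>)) + (\<sigma> * B q \<omega> - \<sigma> * B p \<omega>)"
        if "0 \<le> p" "p \<le> q" for p q
        by (rule incr[OF that])
      show "incseq (two_phase_grid t s (Suc N))" for N
        by (rule two_phase_grid_incseq[OF assms])
      show "two_phase_grid t s (Suc N) 0 = 0" "two_phase_grid t s (Suc N) (Suc N + Suc N) = t + s" for N
        by (rule two_phase_grid_simps[OF zero_less_Suc])+
    qed (rule k)
  qed
  show "AE \<omega> in M. (\<lambda>N. X y t \<omega> - euler_chain (two_phase_grid t s (Suc N)) y \<omega> (Suc N)) \<longlonglongrightarrow> 0"
    using conv[of "\<lambda>N. Suc N"] by (simp add: two_phase_grid_simps)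
  show "AE \<omega> in M. (\<lambda>N. X y (t + s) \<omega> - euler_chain (two_phase_grid t s (Suc N)) y \<omega> (Suc N + Suc N)) \<longlonglongrightarrow> 0"
    using conv[of "\<lambda>N. Suc N + Suc N"] by (simp only: two_phase_grid_simps zero_less_Suc order_refl)
qed

text \<open>Facts \<open>1\<close> and \<open>2\<close> replace the solution by the chain at
  \<open>t + s\<close> and at \<open>t\<close>; \<open>3\<close> is the exact Markov property of the
  chain. Since the test function \<open>\<phi> N\<close> changes with the grid, \<open>2\<close>
  relies on its Lipschitz constant being uniform in \<open>N\<close>.\<close>

lemma expectation_euler_kernel_pow_tendsto:
  assumes "0 \<le> t" "0 < s" and f: "bounded_lipschitz C L f" and "0 \<le> L"
  shows "(\<lambda>N. expectation (\<lambda>\<omega>. (euler_kernel (s / real (Suc N)) ^^ Suc N) f (X y t \<omega>)))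
    \<longlonglongrightarrow> expectation (\<lambda>\<omega>. f (X y (t + s) \<omega>))"
proof -
  define \<phi> where "\<phi> N = (euler_kernel (s / real (Suc N)) ^^ Suc N) f" for N
  define E where "E N = euler_chain (two_phase_grid t s (Suc N)) y" for N
  have \<phi>: "bounded_lipschitz C L (\<phi> N)" for N
    unfolding \<phi>_def using assms by (intro bounded_lipschitz_euler_kernel_pow) auto
  have grid: "incseq (two_phase_grid t s (Suc N))" "0 \<le> two_phase_grid t s (Suc N) 0" for N
    using assms by (auto intro: two_phase_grid_incseq simp: two_phase_grid_simps)
  have E_meas: "(\<lambda>\<omega>. E N \<omega> k) \<in> borel_measurable M" for N k
    unfolding E_def by (intro euler_chain_measurable grid)
  have 1: "(\<lambda>N. expectation (\<lambda>\<omega>. f (X y (t + s) \<omega>)) - expectation (\<lambda>\<omega>. f (E N \<omega> (Suc N + Suc N)))) \<longlonglongrightarrow> 0"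
    using assms euler_chain_converges(2)[of t s y]
    by (intro expectation_bounded_lipschitz_asymp[OF f] E_meas X_measurable) (auto simp: E_def)
  have 2: "(\<lambda>N. expectation (\<lambda>\<omega>. \<phi> N (X y t \<omega>)) - expectation (\<lambda>\<omega>. \<phi> N (E N \<omega> (Suc N)))) \<longlonglongrightarrow> 0"
    using assms euler_chain_converges(1)[of t s y]
    by (intro expectation_bounded_lipschitz_asymp[OF \<phi>] E_meas X_measurable) (auto simp: E_def)
  have 3: "expectation (\<lambda>\<omega>. f (E N \<omega> (Suc N + Suc N))) = expectation (\<lambda>\<omega>. \<phi> N (E N \<omega> (Suc N)))" for N
    unfolding E_def \<phi>_def using assms grid
    by (intro expectation_euler_chain[where C = C and L = L]) (auto simp: two_phase_grid_step simp del: of_nat_Suc)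
  have "(\<lambda>N. expectation (\<lambda>\<omega>. \<phi> N (X y t \<omega>)) - expectation (\<lambda>\<omega>. f (X y (t + s) \<omega>))) \<longlonglongrightarrow> 0"
    using tendsto_diff[OF 2 1] unfolding 3 by simp
  then show ?thesis
    unfolding \<phi>_def by (rule LIM_zero_cancel)
qed

text \<open>The case \<open>t = 0\<close>: a degenerate first phase yields the scheme started at \<open>y\<close>.\<close>

lemma euler_kernel_pow_tendsto:
  assumes "0 < s" and f: "bounded_lipschitz C L f" and "0 \<le> L"
  shows "(\<lambda>N. (euler_kernel (s / real (Suc N)) ^^ Suc N) f y) \<longlonglongrightarrow> expectation (\<lambda>\<omega>. f (X y s \<omega>))"
proof -
  have "expectation (\<lambda>\<omega>. (euler_kernel (s / real (Suc N)) ^^ Suc N) f (X y 0 \<omega>)) =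
      expectation (\<lambda>\<omega>. (euler_kernel (s / real (Suc N)) ^^ Suc N) f y)" for N
  proof (rule integral_cong_AE)
    show "AE \<omega> in M. (euler_kernel (s / real (Suc N)) ^^ Suc N) f (X y 0 \<omega>) =
        (euler_kernel (s / real (Suc N)) ^^ Suc N) f y"
      by (rule eventually_mono[OF X_solution[of y]]) (erule conjE, rule arg_cong)
    have "bounded_lipschitz C L ((euler_kernel (s / real (Suc N)) ^^ Suc N) f)"
      using assms by (intro bounded_lipschitz_euler_kernel_pow) auto
    then show "(\<lambda>\<omega>. (euler_kernel (s / real (Suc N)) ^^ Suc N) f (X y 0 \<omega>)) \<in> borel_measurable M"
      by (rule measurable_compose[OF X_measurable[OF order_refl] bounded_lipschitz_measurable])
  qed simp
  then show ?thesis
    using expectation_euler_kernel_pow_tendsto[OF order_refl assms, of y] by (simp add: prob_space)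
qed

text \<open>A pointwise limit of functions with common \<open>C\<close> and \<open>L\<close> keeps
  both. Measurability in the starting point is derived from this.\<close>

lemma bounded_lipschitz_transition:
  assumes "0 < s" and f: "bounded_lipschitz C L f" and "0 \<le> L"
  shows "bounded_lipschitz C L (\<lambda>y. expectation (\<lambda>\<omega>. f (X y s \<omega>)))"
proof -
  let ?\<phi> = "\<lambda>N. (euler_kernel (s / real (Suc N)) ^^ Suc N) f"
  have "bounded_lipschitz C L (?\<phi> N)" for N
    using assms by (intro bounded_lipschitz_euler_kernel_pow) auto
  then have bound: "\<bar>?\<phi> N y\<bar> \<le> C" and lip: "\<bar>?\<phi> N y - ?\<phi> N z\<bar> \<le> L * \<bar>y - z\<bar>" for N y z
    unfolding bounded_lipschitz_def by blast+
  note lim = euler_kernel_pow_tendsto[OF assms]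
  show ?thesis
    unfolding bounded_lipschitz_def
    using LIMSEQ_le_const2[OF tendsto_rabs[OF lim]] LIMSEQ_le_const2[OF tendsto_rabs[OF tendsto_diff[OF lim lim]]]
      bound lip by blast
qed

text \<open>Both sides are limits of the same sequence, the expected iterated kernel at
  \<open>X y t\<close>: one by the two-phase grid, the other by pointwise convergence at every
  starting point and dominated convergence.\<close>

lemma markov_property:
  assumes "0 \<le> t" "0 < s" and f: "bounded_lipschitz C L f" and "0 \<le> L"
  shows "expectation (\<lambda>\<omega>. f (X y (t + s) \<omega>)) =
    expectation (\<lambda>\<omega>. \<integral>\<omega>'. f (X (X y t \<omega>) s \<omega>') \<partial>M)"
proof (rule LIMSEQ_unique[OF expectation_euler_kernel_pow_tendsto[OF assms]])
  let ?\<phi> = "\<lambda>N. (euler_kernel (s / real (Suc N)) ^^ Suc N) f"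
  have \<phi>: "bounded_lipschitz C L (?\<phi> N)" for N
    using assms by (intro bounded_lipschitz_euler_kernel_pow) auto
  note X = X_measurable[OF \<open>0 \<le> t\<close>]
  show "(\<lambda>N. expectation (\<lambda>\<omega>. ?\<phi> N (X y t \<omega>))) \<longlonglongrightarrow> expectation (\<lambda>\<omega>. \<integral>\<omega>'. f (X (X y t \<omega>) s \<omega>') \<partial>M)"
  proof (rule integral_dominated_convergence[where w = "\<lambda>_. C"])
    show "(\<lambda>\<omega>. \<integral>\<omega>'. f (X (X y t \<omega>) s \<omega>') \<partial>M) \<in> borel_measurable M"
      by (rule measurable_compose[OF X bounded_lipschitz_measurable[OF bounded_lipschitz_transition[OF assms(2-)]]])
    show "(\<lambda>\<omega>. ?\<phi> N (X y t \<omega>)) \<in> borel_measurable M" for N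
      by (rule measurable_compose[OF X bounded_lipschitz_measurable[OF \<phi>]])
    show "AE \<omega> in M. norm (?\<phi> N (X y t \<omega>)) \<le> C" for N
      using \<phi>[of N] unfolding bounded_lipschitz_def real_norm_def by blast
    show "AE \<omega> in M. (\<lambda>N. ?\<phi> N (X y t \<omega>)) \<longlonglongrightarrow> (\<integral>\<omega>'. f (X (X y t \<omega>) s \<omega>') \<partial>M)"
      by (intro AE_I2 euler_kernel_pow_tendsto[OF assms(2-)])
  qed simp
qed

section \<open>Transition kernels and the Chapman-Kolmogorov equation\<close>

abbreviation transition :: "real \<Rightarrow> real \<Rightarrow> real measure" where
  "transition s y \<equiv> distr M borel (X y s)"

lemma expectation_cts_step_tendsto:
  assumes "0 \<le> s"
  shows "(\<lambda>n. expectation (\<lambda>\<omega>. cts_step c (c + 1 / real (Suc n)) (X y s \<omega>)))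
    \<longlonglongrightarrow> measure (transition s y) {..c}"
proof -
  note [measurable] = X_measurable[OF assms]
  have "measure (transition s y) {..c} = expectation (\<lambda>\<omega>. indicator {..c} (X y s \<omega>))"
    using integral_distr[of "X y s" M borel "indicator {..c} :: real \<Rightarrow> real"] by simp
  moreover have "(\<lambda>n. expectation (\<lambda>\<omega>. cts_step c (c + 1 / real (Suc n)) (X y s \<omega>)))
    \<longlonglongrightarrow> expectation (\<lambda>\<omega>. indicator {..c} (X y s \<omega>))"
  proof (rule integral_dominated_convergence[where w = "\<lambda>_. 1"])
    show "(\<lambda>\<omega>. cts_step c (c + 1 / real (Suc n)) (X y s \<omega>)) \<in> borel_measurable M" for n
      by (rule measurable_compose[OF X_measurable[OF assms] bounded_lipschitz_measurable[OF bounded_lipschitz_cts_step_Suc]])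
    show "AE \<omega> in M. norm (cts_step c (c + 1 / real (Suc n)) (X y s \<omega>)) \<le> 1" for n
      using bounded_lipschitz_cts_step_Suc[of n c] unfolding bounded_lipschitz_def real_norm_def by blast
  qed (use cts_step_tendsto in \<open>auto simp del: of_nat_Suc\<close>)
  ultimately show ?thesis by simp
qed

text \<open>Closed half-lines form an intersection-stable generator, and their transition
  probabilities are pointwise limits of Lipschitz functions of the starting point.\<close>

lemma transition_measurable:
  assumes "0 < s"
  shows "transition s \<in> borel \<rightarrow>\<^sub>M prob_algebra borel"
proof (rule measurable_prob_algebra_generated[where \<Omega> = UNIV and G = "range (\<lambda>c. {..c})"])
  note [measurable] = X_measurable[OF less_imp_le[OF assms]]
  show "sets borel = sigma_sets UNIV (range (\<lambda>c::real. {..c}))"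
    by (subst borel_eq_atMost) simp
  show "Int_stable (range (\<lambda>c::real. {..c}))"
    by (auto simp: Int_stable_def)
  show "prob_space (transition s y)" for y
    by (rule prob_space_distr) simp
  then interpret T: prob_space "transition s y" for y .
  fix A assume "A \<in> range (\<lambda>c::real. {..c})"
  then obtain c where A: "A = {..c}" by blast
  have "(\<lambda>y. measure (transition s y) {..c}) \<in> borel_measurable borel"
    by (rule borel_measurable_LIMSEQ_real[OF expectation_cts_step_tendsto
          bounded_lipschitz_measurable[OF bounded_lipschitz_transition[OF _ bounded_lipschitz_cts_step_Suc]]])
      (use assms in auto)
  then show "(\<lambda>y. emeasure (transition s y) A) \<in> borel_measurable borel"
    unfolding A T.emeasure_eq_measure by measurable
qed auto

text \<open>It suffices to compare distribution functions. The Markov property is available for the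
  ramps, which then steepen to the indicator of \<open>{..c}\<close>.\<close>

lemma chapman_kolmogorov:
  assumes "0 \<le> t" "0 < s"
  shows "transition (t + s) y = transition t y \<bind> transition s"
proof (rule cdf_unique)
  note X = X_measurable[OF \<open>0 \<le> t\<close>]
  interpret T: prob_space "transition t y"
    using X by (rule prob_space_distr)
  have K: "transition s \<in> transition t y \<rightarrow>\<^sub>M prob_algebra borel"
    using transition_measurable[OF \<open>0 < s\<close>] by (simp cong: measurable_cong_sets)
  then have K': "transition s \<in> transition t y \<rightarrow>\<^sub>M subprob_algebra borel"
    by (rule measurable_prob_algebraD)
  show "real_distribution (transition (t + s) y)"
    using assms by (intro real_distribution_distr X_measurable) simp
  show "real_distribution (transition t y \<bind> transition s)"
    unfolding real_distribution_def real_distribution_axioms_def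
  proof
    show "prob_space (transition t y \<bind> transition s)"
      using X_measurable assms by (intro T.prob_space_bind[OF _ K'] AE_I2 prob_space_distr) simp
    show "sets (transition t y \<bind> transition s) = sets borel"
      by (rule sets_bind) (auto simp: T.not_empty)
  qed
  show "cdf (transition (t + s) y) = cdf (transition t y \<bind> transition s)"
  proof
    fix c
    let ?f = "\<lambda>n. cts_step c (c + 1 / real (Suc n))"
    let ?\<phi> = "\<lambda>n z. expectation (\<lambda>\<omega>. ?f n (X z s \<omega>))"
    have \<phi>: "bounded_lipschitz 1 (real (Suc n)) (?\<phi> n)" for n
      using assms by (intro bounded_lipschitz_transition bounded_lipschitz_cts_step_Suc) auto
    have lim: "(\<lambda>n. ?\<phi> n z) \<longlonglongrightarrow> measure (transition s z) {..c}" for z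
      using assms by (intro expectation_cts_step_tendsto) simp
    have meas: "?\<phi> n \<in> borel_measurable borel" for n
      by (rule bounded_lipschitz_measurable[OF \<phi>])
    have "(\<lambda>n. \<integral>z. ?\<phi> n z \<partial>transition t y) \<longlonglongrightarrow> (\<integral>z. measure (transition s z) {..c} \<partial>transition t y)"
    proof (rule integral_dominated_convergence[where w = "\<lambda>_. 1"])
      show "(\<lambda>z. measure (transition s z) {..c}) \<in> borel_measurable (transition t y)"
        using borel_measurable_LIMSEQ_real[OF lim meas] by simp
      show "AE z in transition t y. norm (?\<phi> n z) \<le> 1" for n
        using \<phi>[of n] unfolding bounded_lipschitz_def real_norm_def by blast
    qed (use lim meas in auto)
    moreover have "(\<integral>z. ?\<phi> n z \<partial>transition t y) = expectation (\<lambda>\<omega>. ?f n (X y (t + s) \<omega>))" for n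
      using markov_property[OF assms bounded_lipschitz_cts_step_Suc] X meas
      by (subst integral_distr) auto
    moreover have "(\<lambda>n. expectation (\<lambda>\<omega>. ?f n (X y (t + s) \<omega>))) \<longlonglongrightarrow> measure (transition (t + s) y) {..c}"
      using assms by (intro expectation_cts_step_tendsto) simp
    ultimately have "measure (transition (t + s) y) {..c} = (\<integral>z. measure (transition s z) {..c} \<partial>transition t y)"
      using LIMSEQ_unique by (simp only:)
    then show "cdf (transition (t + s) y) c = cdf (transition t y \<bind> transition s) c"
      using T.measure_bind[OF K', of "{..c}"] by (simp add: cdf_def)
  qed
qed

end

subsection \<open>Total variation and mixing times\<close>

lemma abs_measure_diff_le_tv_dist:
  assumes "prob_space \<nu>" "prob_space \<mu>" "F \<in> sets \<nu>"
  shows "\<bar>measure \<nu> F - measure \<mu> F\<bar> \<le> tv_dist \<nu> \<mu>"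
proof -
  \<comment> \<open>A real supremum is known to dominate its members once the set is bounded
    above.\<close>
  have "\<bar>measure \<nu> F' - measure \<mu> F'\<bar> \<le> 1" for F'
    using prob_space.prob_le_1[OF assms(1), of F'] prob_space.prob_le_1[OF assms(2), of F']
      measure_nonneg[of \<nu> F'] measure_nonneg[of \<mu> F'] by linarith
  then have "bdd_above ((\<lambda>F. \<bar>measure \<nu> F - measure \<mu> F\<bar>) ` sets \<nu>)"
    by (intro bdd_aboveI2)
  then show ?thesis
    unfolding tv_dist_def using assms(3) by (intro cSUP_upper)
qed

text \<open>The sum counts the levels \<open>k / n\<close> not exceeding \<open>v\<close>; there are
  \<open>\<lfloor>n * v\<rfloor>\<close> of them, so it rounds \<open>n * v\<close> down.\<close>

lemma abs_diff_sum_superlevel_indicators_le: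
  fixes v :: real
  assumes "0 \<le> v" "v \<le> 1" "0 < n"
  shows "\<bar>v - (\<Sum>k=1..n. of_bool (real k / real n \<le> v)) / real n\<bar> \<le> 1 / real n"
proof -
  have "{1..n} \<inter> {k. real k / real n \<le> v} = {1..nat \<lfloor>real n * v\<rfloor>}"
  proof (intro set_eqI)
    fix k
    have "real n * v \<le> real n"
      using mult_left_mono[OF \<open>v \<le> 1\<close>, of "real n"] by simp
    then have "k \<le> n" if "real k \<le> real n * v"
      using that by linarith
    moreover have "real k \<le> real n * v \<longleftrightarrow> k \<le> nat \<lfloor>real n * v\<rfloor>"
      using assms by (simp add: le_nat_iff le_floor_iff)
    ultimately show "k \<in> {1..n} \<inter> {k. real k / real n \<le> v} \<longleftrightarrow> k \<in> {1..nat \<lfloor>real n * v\<rfloor>}"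
      using \<open>0 < n\<close> by (auto simp: divide_le_eq mult.commute)
  qed
  then have "(\<Sum>k=1..n. of_bool (real k / real n \<le> v)) = real (nat \<lfloor>real n * v\<rfloor>)"
    by (subst sum_of_bool_eq) auto
  also have "\<dots> = of_int \<lfloor>real n * v\<rfloor>"
    using assms by simp
  finally have "v - (\<Sum>k=1..n. of_bool (real k / real n \<le> v)) / real n = (real n * v - of_int \<lfloor>real n * v\<rfloor>) / real n"
    using \<open>0 < n\<close> by (simp add: field_simps)
  also have "\<bar>\<dots>\<bar> \<le> 1 / real n"
  proof -
    have "0 \<le> real n * v - of_int \<lfloor>real n * v\<rfloor>" "real n * v - of_int \<lfloor>real n * v\<rfloor> \<le> 1"
      by linarith+
    then show ?thesis
      by (simp add: divide_right_mono)
  qed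
  finally show ?thesis .
qed

text \<open>A discrete layer-cake argument: each integral is within \<open>1 / n\<close> of the
  average measure of \<open>n\<close> superlevel sets of \<open>\<phi>\<close>, and the measure of
  each set changes by at most \<open>tv_dist \<nu> \<mu>\<close>. This gives the bound with constant
  one.\<close>

lemma abs_integral_diff_le_tv_dist:
  fixes \<phi> :: "'b \<Rightarrow> real"
  assumes \<nu>: "prob_space \<nu>" and \<mu>: "prob_space \<mu>" and sets: "sets \<mu> = sets \<nu>"
    and [measurable]: "\<phi> \<in> borel_measurable \<nu>" and \<phi>: "\<And>z. 0 \<le> \<phi> z" "\<And>z. \<phi> z \<le> 1"
  shows "\<bar>(\<integral>z. \<phi> z \<partial>\<nu>) - (\<integral>z. \<phi> z \<partial>\<mu>)\<bar> \<le> tv_dist \<nu> \<mu>"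
proof -
  have [measurable]: "\<phi> \<in> borel_measurable \<mu>"
    using sets by (simp cong: measurable_cong_sets)
  have space: "space \<mu> = space \<nu>"
    using sets by (rule sets_eq_imp_space_eq)
  define A where "A n k = {z \<in> space \<nu>. real k / real n \<le> \<phi> z}" for n k :: nat
  have A: "A n k \<in> sets \<nu>" for n k
    unfolding A_def by measurable
  have approx: "\<bar>(\<integral>z. \<phi> z \<partial>N) - (\<Sum>k=1..n. measure N (A n k)) / real n\<bar> \<le> 1 / real n"
    if "prob_space N" and [measurable_cong]: "sets N = sets \<nu>" and "0 < n" for N n
  proof -
    interpret N: prob_space N by fact
    have [measurable]: "\<phi> \<in> borel_measurable N" by simp
    have [simp]: "A n k \<in> sets N" for k using A that by simp
    have space_N: "space N = space \<nu>" using that(2) by (rule sets_eq_imp_space_eq)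
    have int\<phi>: "integrable N \<phi>"
      by (rule N.integrable_const_bound[where B = 1]) (auto simp: \<phi>)
    have intA: "integrable N (\<lambda>z. (\<Sum>k=1..n. indicator (A n k) z) / real n)"
      by (intro integrable_divide Bochner_Integration.integrable_sum integrable_real_indicator)
        (auto simp: N.emeasure_finite less_top[symmetric])
    have "(\<integral>z. \<phi> z \<partial>N) - (\<Sum>k=1..n. measure N (A n k)) / real n =
        (\<integral>z. \<phi> z - (\<Sum>k=1..n. indicator (A n k) z) / real n \<partial>N)"
      using int\<phi> intA
      by (simp add: Bochner_Integration.integral_sum N.emeasure_finite less_top[symmetric])
    also have "\<bar>\<dots>\<bar> \<le> (\<integral>z. \<bar>\<phi> z - (\<Sum>k=1..n. indicator (A n k) z) / real n\<bar> \<partial>N)"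
      by (rule integral_abs_bound)
    also have "\<dots> \<le> 1 / real n"
    proof (rule N.integral_le_const)
      show "integrable N (\<lambda>z. \<bar>\<phi> z - (\<Sum>k=1..n. indicator (A n k) z) / real n\<bar>)"
        by (intro integrable_abs Bochner_Integration.integrable_diff int\<phi> intA)
      show "AE z in N. \<bar>\<phi> z - (\<Sum>k=1..n. indicator (A n k) z) / real n\<bar> \<le> 1 / real n"
        using abs_diff_sum_superlevel_indicators_le[OF \<phi> \<open>0 < n\<close>]
        by (intro AE_I2) (auto simp: A_def indicator_def of_bool_def space_N)
    qed
    finally show ?thesis .
  qed
  \<comment> \<open>The numerator 2 collects one discretization error for each measure.\<close>
  have "\<bar>(\<integral>z. \<phi> z \<partial>\<nu>) - (\<integral>z. \<phi> z \<partial>\<mu>)\<bar> \<le> tv_dist \<nu> \<mu> + 2 / real (Suc n)" for n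
  proof -
    let ?S = "\<lambda>N. (\<Sum>k=1..Suc n. measure N (A (Suc n) k)) / real (Suc n)"
    have "\<bar>?S \<nu> - ?S \<mu>\<bar> = \<bar>\<Sum>k=1..Suc n. measure \<nu> (A (Suc n) k) - measure \<mu> (A (Suc n) k)\<bar> / real (Suc n)"
      unfolding sum_subtractf diff_divide_distrib[symmetric] abs_divide by simp
    also have "\<dots> \<le> (\<Sum>k=1..Suc n. tv_dist \<nu> \<mu>) / real (Suc n)"
      by (intro divide_right_mono order_trans[OF sum_abs sum_mono] abs_measure_diff_le_tv_dist \<nu> \<mu> A) simp
    also have "\<dots> = tv_dist \<nu> \<mu>"
      by simp
    finally show ?thesis
      using approx[OF \<nu> refl, of "Suc n"] approx[OF \<mu> sets, of "Suc n"] by simp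
  qed
  moreover have "(\<lambda>n. tv_dist \<nu> \<mu> + 2 / real (Suc n)) \<longlonglongrightarrow> tv_dist \<nu> \<mu> + 0"
    by (intro tendsto_add tendsto_const LIMSEQ_Suc[OF lim_const_over_n])
  ultimately show ?thesis
    by (intro LIMSEQ_le_const[of "\<lambda>n. tv_dist \<nu> \<mu> + 2 / real (Suc n)"]) auto
qed

text \<open>For fixed \<open>F\<close>, the probability of \<open>F\<close> under \<open>K z\<close>
  is a function of \<open>z\<close> with values in \<open>[0, 1]\<close>, so the bound on integrals
  applies.\<close>

lemma tv_dist_bind_le:
  assumes \<nu>: "prob_space \<nu>" and \<mu>: "prob_space \<mu>" and sets: "sets \<mu> = sets \<nu>"
    and K: "K \<in> \<nu> \<rightarrow>\<^sub>M prob_algebra S"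
  shows "tv_dist (\<nu> \<bind> K) (\<mu> \<bind> K) \<le> tv_dist \<nu> \<mu>"
proof -
  interpret \<nu>: prob_space \<nu> by fact
  interpret \<mu>: prob_space \<mu> by fact
  have K': "K \<in> \<nu> \<rightarrow>\<^sub>M subprob_algebra S"
    using K by (rule measurable_prob_algebraD)
  have K'': "K \<in> \<mu> \<rightarrow>\<^sub>M subprob_algebra S"
    using K' sets by (simp cong: measurable_cong_sets)
  have sets_bind: "sets (\<nu> \<bind> K) = sets S"
    using sets_kernel[OF K'] by (rule sets_bind) (auto simp: \<nu>.not_empty)
  have space: "space \<mu> = space \<nu>"
    using sets by (rule sets_eq_imp_space_eq)
  show ?thesis
    unfolding tv_dist_def[of "\<nu> \<bind> K"] sets_bind
  proof (rule cSUP_least)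
    fix F assume F: "F \<in> sets S"
    \<comment> \<open>The integral bound asks for values in \<open>[0, 1]\<close> at every
      \<open>z\<close>, while \<open>K z\<close> is known to be a probability only on the space of
      \<open>\<nu>\<close>; the default zero covers the rest.\<close>
    let ?\<phi> = "\<lambda>z. if z \<in> space \<nu> then measure (K z) F else 0"
    have "measure (\<nu> \<bind> K) F = (\<integral>z. ?\<phi> z \<partial>\<nu>)"
      unfolding \<nu>.measure_bind[OF K' F] by (intro Bochner_Integration.integral_cong) auto
    moreover have "measure (\<mu> \<bind> K) F = (\<integral>z. ?\<phi> z \<partial>\<mu>)"
      unfolding \<mu>.measure_bind[OF K'' F] by (intro Bochner_Integration.integral_cong) (auto simp: space)
    moreover have "\<bar>(\<integral>z. ?\<phi> z \<partial>\<nu>) - (\<integral>z. ?\<phi> z \<partial>\<mu>)\<bar> \<le> tv_dist \<nu> \<mu>"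
    proof (rule abs_integral_diff_le_tv_dist[OF \<nu> \<mu> sets])
      have "(\<lambda>z. measure (K z) F) \<in> borel_measurable \<nu>"
        using measurable_compose[OF K' measurable_measure_subprob_algebra[OF F]] .
      then show "?\<phi> \<in> borel_measurable \<nu>"
        by (simp cong: measurable_cong)
      show "?\<phi> z \<le> 1" for z
        using measurable_space[OF K, of z] by (auto simp: space_prob_algebra intro: prob_space.prob_le_1)
    qed simp
    ultimately show "\<bar>measure (\<nu> \<bind> K) F - measure (\<mu> \<bind> K) F\<bar> \<le> tv_dist \<nu> \<mu>" by simp
  qed auto
qed

text \<open>The law at \<open>t'\<close> is the law at \<open>t\<close> sent through the kernel of
  duration \<open>t' - t\<close>, which fixes \<open>\<mu>\<close> and contracts total
  variation.\<close>

lemma (in monotone_sde) tv_to_antimono: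
  assumes inv: "invariant_prob M X \<mu>" and "0 \<le> t" "t \<le> t'"
  shows "tv_to M (X y) \<mu> t' \<le> tv_to M (X y) \<mu> t"
proof (cases "t = t'")
  \<comment> \<open>The kernel lemmas require a positive duration, so \<open>t = t'\<close> is set
    apart.\<close>
  case False
  define s where "s = t' - t"
  have s: "0 < s" "t' = t + s" using False assms by (auto simp: s_def)
  have \<mu>: "prob_space \<mu>" and sets: "sets \<mu> = sets borel"
    and inv_s: "\<And>A. A \<in> sets borel \<Longrightarrow> (\<integral>\<^sup>+ z. emeasure (transition s z) A \<partial>\<mu>) = emeasure \<mu> A"
    using inv s(1) by (auto simp: invariant_prob_def)
  interpret \<mu>: prob_space \<mu> by fact
  have K: "transition s \<in> N \<rightarrow>\<^sub>M prob_algebra borel" if "sets N = sets borel" for N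
    using transition_measurable[OF s(1)] that by (simp cong: measurable_cong_sets)
  have "\<mu> = \<mu> \<bind> transition s"
  proof (rule measure_eqI)
    show "sets \<mu> = sets (\<mu> \<bind> transition s)"
      by (subst sets_bind[where N = borel]) (auto simp: \<mu>.not_empty sets)
    fix A assume "A \<in> sets \<mu>"
    then show "emeasure \<mu> A = emeasure (\<mu> \<bind> transition s) A"
      using inv_s[of A] sets
      by (subst emeasure_bind[OF \<mu>.not_empty measurable_prob_algebraD[OF K[OF sets]]]) auto
  qed
  then have "tv_dist (transition t y \<bind> transition s) \<mu> =
      tv_dist (transition t y \<bind> transition s) (\<mu> \<bind> transition s)"
    by simp
  also have "\<dots> \<le> tv_dist (transition t y) \<mu>"
    using sets by (intro tv_dist_bind_le[OF prob_space_distr[OF X_measurable[OF \<open>0 \<le> t\<close>]] \<mu> _ K]) auto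
  finally show ?thesis
    using chapman_kolmogorov[OF \<open>0 \<le> t\<close> s(1)] by (simp add: tv_to_def s(2))
qed simp

section \<open>Comparing time scales, and limits of mixing times\<close>

lemma no_common_cutoff_scale:
  fixes d :: "real \<Rightarrow> real \<Rightarrow> real" and a T :: "real \<Rightarrow> real"
  assumes "F \<noteq> bot"
    and anti: "\<forall>\<^sub>F \<epsilon> in F. \<forall>s t. 0 \<le> s \<longrightarrow> s \<le> t \<longrightarrow> d \<epsilon> t \<le> d \<epsilon> s"
    and a: "\<forall>\<^sub>F \<epsilon> in F. 0 < a \<epsilon>" and T: "\<forall>\<^sub>F \<epsilon> in F. 0 < T \<epsilon>"
    and liminf: "0 < Liminf F (\<lambda>\<epsilon>. ereal (d \<epsilon> (a \<epsilon> * 4)))"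
    and limsup: "Limsup F (\<lambda>\<epsilon>. ereal (d \<epsilon> (a \<epsilon> * 1))) < 1"
    and before: "((\<lambda>\<epsilon>. d \<epsilon> (1/2 * T \<epsilon>)) \<longlongrightarrow> 1) F"
    and after: "((\<lambda>\<epsilon>. d \<epsilon> (2 * T \<epsilon>)) \<longlongrightarrow> 0) F"
  shows False
proof -
  \<comment> \<open>Levels strictly inside the gaps: eventually \<open>d\<close> exceeds
    \<open>c > 0\<close> at time \<open>4 * a\<close> and stays below \<open>c' < 1\<close> at time
    \<open>a\<close>.\<close>
  obtain c where c: "0 < ereal c" "ereal c < Liminf F (\<lambda>\<epsilon>. ereal (d \<epsilon> (a \<epsilon> * 4)))"
    using ereal_dense2[OF liminf] by blast
  obtain c' where c': "Limsup F (\<lambda>\<epsilon>. ereal (d \<epsilon> (a \<epsilon> * 1))) < ereal c'" "ereal c' < 1"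
    using ereal_dense2[OF limsup] by blast
  have lower: "\<forall>\<^sub>F \<epsilon> in F. c < d \<epsilon> (a \<epsilon> * 4)"
    using less_LiminfD[OF c(2)] by simp
  have upper: "\<forall>\<^sub>F \<epsilon> in F. d \<epsilon> (a \<epsilon> * 1) < c'"
    using Limsup_lessD[OF c'(1)] by simp
  have late: "\<forall>\<^sub>F \<epsilon> in F. d \<epsilon> (2 * T \<epsilon>) < c"
    using order_tendstoD(2)[OF after] c(1) by simp
  have early: "\<forall>\<^sub>F \<epsilon> in F. c' < d \<epsilon> (1/2 * T \<epsilon>)"
    using order_tendstoD(1)[OF before] c'(2) by simp
  from lower upper late early anti a T have "\<forall>\<^sub>F \<epsilon> in F. False"
  proof eventually_elim
    case (elim \<epsilon>)
    \<comment> \<open>A larger value of a nonincreasing function is taken earlier. The factors 4, 2,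
      1/2 and 1 are matched so that the two resulting inequalities contradict each other.\<close>
    have "a \<epsilon> * 4 < 2 * T \<epsilon>"
    proof (rule ccontr)
      assume "\<not> a \<epsilon> * 4 < 2 * T \<epsilon>"
      then have "d \<epsilon> (a \<epsilon> * 4) \<le> d \<epsilon> (2 * T \<epsilon>)"
        using elim(5,7) by simp
      with elim show False by simp
    qed
    moreover have "1/2 * T \<epsilon> < a \<epsilon> * 1"
    proof (rule ccontr)
      assume "\<not> 1/2 * T \<epsilon> < a \<epsilon> * 1"
      then have "d \<epsilon> (1/2 * T \<epsilon>) \<le> d \<epsilon> (a \<epsilon> * 1)"
        using elim(5,6) by simp
      with elim show False by simp
    qed
    ultimately show False by simp
  qed
  with \<open>F \<noteq> bot\<close> show False by (simp add: eventually_False)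
qed

lemma mixing_time_le:
  assumes "0 \<le> t" "d t \<le> \<eta>"
  shows "mixing_time d \<eta> \<le> ereal t"
  unfolding mixing_time_def using assms by (intro Inf_lower) auto

lemma mixing_time_ge:
  assumes "\<And>s. 0 \<le> s \<Longrightarrow> s \<le> t \<Longrightarrow> d t \<le> d s" "\<eta> < d t"
  shows "ereal t \<le> mixing_time d \<eta>"
  unfolding mixing_time_def
proof (rule Inf_greatest)
  fix u assume "u \<in> {ereal s | s. 0 \<le> s \<and> d s \<le> \<eta>}"
  then obtain s where "u = ereal s" "0 \<le> s" "d s \<le> \<eta>" by blast
  then show "ereal t \<le> u"
    using assms(1)[of s] assms(2) by (cases "s \<le> t") auto
qed

text \<open>For \<open>t\<close> below the infimum, \<open>G t > \<eta>\<close>, so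
  \<open>a * t\<close> eventually precedes mixing; beyond it, mixing has occurred. The order
  topology of \<open>ereal\<close> also covers an empty set of times.\<close>

lemma scaled_mixing_time_tendsto:
  fixes d :: "real \<Rightarrow> real \<Rightarrow> real" and a G :: "real \<Rightarrow> real"
  assumes anti: "\<forall>\<^sub>F \<epsilon> in F. \<forall>s t. 0 \<le> s \<longrightarrow> s \<le> t \<longrightarrow> d \<epsilon> t \<le> d \<epsilon> s"
    and a: "\<forall>\<^sub>F \<epsilon> in F. 0 < a \<epsilon>"
    and lim: "\<And>t. 0 < t \<Longrightarrow> ((\<lambda>\<epsilon>. d \<epsilon> (a \<epsilon> * t)) \<longlongrightarrow> G t) F"
    and G: "strict_antimono_on {0<..} G"
  shows "((\<lambda>\<epsilon>. mixing_time (d \<epsilon>) \<eta> / ereal (a \<epsilon>)) \<longlongrightarrow> Inf {ereal t | t. 0 < t \<and> G t \<le> \<eta>}) F"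
    (is "(?m \<longlongrightarrow> ?I) F")
proof (rule order_tendstoI)
  fix u assume "u < ?I"
  show "\<forall>\<^sub>F \<epsilon> in F. u < ?m \<epsilon>"
  proof (cases "u < 0")
    \<comment> \<open>Limits of \<open>d\<close> are given at positive \<open>t\<close> only, so
      negative \<open>u\<close> is settled by nonnegativity of the mixing time.\<close>
    case True
    have "0 \<le> mixing_time (d \<epsilon>) \<eta>" for \<epsilon>
      unfolding mixing_time_def by (intro Inf_greatest) auto
    then have "0 \<le> ?m \<epsilon>" if "0 < a \<epsilon>" for \<epsilon>
      using that by (simp add: ereal_le_divide_pos)
    with True have "u < ?m \<epsilon>" if "0 < a \<epsilon>" for \<epsilon>
      using that less_le_trans by blast
    with a show ?thesis
      by (auto elim: eventually_mono)
  next
    case False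
    obtain t where t: "u < ereal t" "ereal t < ?I"
      using ereal_dense2[OF \<open>u < ?I\<close>] by blast
    have "0 < t"
      using le_less_trans[OF _ t(1)] False by (metis ereal_less(2) not_less)
    moreover have "\<not> G t \<le> \<eta>"
      using t(2) \<open>0 < t\<close> by (auto simp: less_le_not_le intro!: Inf_lower)
    ultimately have "\<forall>\<^sub>F \<epsilon> in F. \<eta> < d \<epsilon> (a \<epsilon> * t)"
      using order_tendstoD(1)[OF lim] by simp
    with anti a show ?thesis
    proof eventually_elim
      case (elim \<epsilon>)
      then have "ereal (a \<epsilon> * t) \<le> mixing_time (d \<epsilon>) \<eta>"
        by (intro mixing_time_ge) auto
      then have "ereal t \<le> ?m \<epsilon>"
        using elim by (subst ereal_le_divide_pos) auto
      with t(1) show ?case by (rule less_le_trans)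
    qed
  qed
next
  fix u assume "?I < u"
  then obtain t where t: "0 < t" "G t \<le> \<eta>" "ereal t < u"
    by (auto simp: Inf_less_iff)
  \<comment> \<open>\<open>G t = \<eta>\<close> is possible, and then convergence does not place
    \<open>d\<close> below \<open>\<eta>\<close> at \<open>a * t\<close>. Strict decrease makes
    \<open>G\<close> strictly smaller than \<open>\<eta>\<close> at a later \<open>t'\<close> still
    below \<open>u\<close>.\<close>
  obtain t' where t': "t < t'" "ereal t' < u"
    using ereal_dense2[OF t(3)] by auto
  have "G t' < \<eta>"
    using monotone_onD[OF G, of t t'] t t' by simp
  then have "\<forall>\<^sub>F \<epsilon> in F. d \<epsilon> (a \<epsilon> * t') < \<eta>"
    using order_tendstoD(2)[OF lim] t t' by simp
  with a show "\<forall>\<^sub>F \<epsilon> in F. ?m \<epsilon> < u"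
  proof eventually_elim
    case (elim \<epsilon>)
    then have "mixing_time (d \<epsilon>) \<eta> \<le> ereal (a \<epsilon> * t')"
      using t t' by (intro mixing_time_le) auto
    then have "?m \<epsilon> \<le> ereal t'"
      using elim by (subst ereal_divide_le_pos) auto
    then show ?case using t'(2) by (rule le_less_trans)
  qed
qed

section \<open>From the potential and the strong solution to the monotone setting\<close>

lemma monotone_function_deriv_convex:
  assumes "twice_cont_differentiable V" "convex_on UNIV V"
  shows "monotone_function (deriv V)"
proof
  show "continuous_on UNIV (deriv V)"
    using assms(1) by (auto simp: twice_cont_differentiable_def intro: differentiable_imp_continuous_on)
  have D: "(V has_field_derivative deriv V z) (at z)" for z
    using assms(1) by (auto simp: twice_cont_differentiable_def differentiable_on_def DERIV_deriv_iff_real_differentiable)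
  have tangent: "deriv V c * (z - c) \<le> V z - V c" for z c
    using D by (intro convex_on_imp_above_tangent[OF assms(2)]) auto
  show "mono (deriv V)"
  proof (rule monoI)
    fix p q :: real assume "p \<le> q"
    \<comment> \<open>The sum of the tangent inequalities at \<open>p\<close> and at
      \<open>q\<close>.\<close>
    have "deriv V p * (q - p) \<le> deriv V q * (q - p)"
      using tangent[of p q] tangent[of q p] by (simp add: algebra_simps)
    then show "deriv V p \<le> deriv V q"
      using \<open>p \<le> q\<close> by (cases "p = q") (auto simp: mult_le_cancel_right)
  qed
qed

text \<open>The generators, preimages under \<open>B s\<close> and null sets of \<open>M\<close>,
  all belong to \<open>sets M\<close>, so the filtration consists of sub-sigma-algebras.\<close>

lemma borel_measurable_augmented_filtration:
  assumes B: "\<And>s. 0 \<le> s \<Longrightarrow> B s \<in> borel_measurable M"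
    and f: "f \<in> borel_measurable (augmented_filtration M B t)"
  shows "f \<in> borel_measurable M"
proof -
  let ?G = "{B s -` A \<inter> space M | s A. 0 \<le> s \<and> s \<le> t \<and> A \<in> sets borel} \<union> null_sets M"
  have G: "?G \<subseteq> sets M"
    using B by (auto intro: measurable_sets)
  then have "?G \<subseteq> Pow (space M)"
    using sets.space_closed by blast
  then have "sets (augmented_filtration M B t) \<subseteq> sets M"
    unfolding augmented_filtration_def by (subst sets_measure_of) (simp_all add: sets.sigma_sets_subset[OF G])
  moreover have "space (augmented_filtration M B t) = space M"
    unfolding augmented_filtration_def using \<open>?G \<subseteq> Pow (space M)\<close> by (simp add: space_measure_of)
  ultimately show ?thesis
    using f by (auto simp: measurable_def)
qed

lemma monotone_sde_strong_solution:
  assumes "monotone_function g" and B: "brownian_motion M B"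
    and X: "\<And>y. strong_solution M B (\<lambda>z. - g z) \<sigma> y (X y)"
  shows "monotone_sde M g B \<sigma> X"
proof -
  have B_meas: "B t \<in> borel_measurable M" if "0 \<le> t" for t
    using B that by (simp add: brownian_motion_def)
  have "distr M borel (\<lambda>\<omega>. B (t + h) \<omega> - B t \<omega>) = density lborel (normal_density 0 (sqrt h))"
    if "0 \<le> t" "0 < h" for t h
  proof -
    have "distributed M lborel (\<lambda>\<omega>. B (t + h) \<omega> - B t \<omega>) (normal_density 0 (sqrt (t + h - t)))"
      using B that unfolding brownian_motion_def by (metis less_add_same_cancel1)
    then have "distr M lborel (\<lambda>\<omega>. B (t + h) \<omega> - B t \<omega>) = density lborel (normal_density 0 (sqrt h))"
      by (simp add: distributed_distr_eq_density)
    then show ?thesis by (simp cong: distr_cong)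
  qed
  moreover have "X y t \<in> borel_measurable M" if "0 \<le> t" for y t
    using X[of y] that B_meas
    by (auto simp: strong_solution_def intro: borel_measurable_augmented_filtration)
  moreover have "prob_space M"
    using B by (simp add: brownian_motion_def)
  ultimately show ?thesis
    using assms(1) B B_meas X
    unfolding monotone_sde_def monotone_sde_axioms_def brownian_motion_def strong_solution_def by blast
qed

section \<open>Absence of cut-off and asymptotics of the mixing times\<close>

theorem proposition1p9:
  fixes V :: "real \<Rightarrow> real"
    and C\<^sub>0 \<alpha> c\<^sub>0 R\<^sub>0 \<beta> x :: real
    and M :: "'a measure"
    and B :: "real \<Rightarrow> 'a \<Rightarrow> real"
    and X :: "real \<Rightarrow> real \<Rightarrow> real \<Rightarrow> 'a \<Rightarrow> real"
    and \<mu> :: "real \<Rightarrow> real measure"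
    and a :: "real \<Rightarrow> real"
  assumes "\<forall>z. 0 \<le> V z"
    and "twice_cont_differentiable V"
    and "convex_on UNIV V"
    and "\<forall>z. V (- z) = V z"
    and "V 0 = 0"
    and "0 < C\<^sub>0" and "0 < \<alpha>"
    and "((\<lambda>r. SUP z\<in>{-1..1}. \<bar>r powr (- 1 - \<alpha>) * deriv V (r * z)
            - C\<^sub>0 * \<bar>z\<bar> powr (1 + \<alpha>) * sgn z\<bar>) \<longlongrightarrow> 0) (at_right 0)"
    and "0 < c\<^sub>0" and "0 < R\<^sub>0" and "- 1 < \<beta>"
    and "\<forall>z\<ge>R\<^sub>0. c\<^sub>0 * z powr (1 + \<beta>) \<le> deriv V z"
    and "brownian_motion M B"
    and "\<forall>\<epsilon>\<in>{0<..1}. \<forall>y. strong_solution M B (\<lambda>z. - deriv V z) (sqrt \<epsilon>) y (X \<epsilon> y)"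
    and "\<forall>\<epsilon>\<in>{0<..1}. invariant_prob M (X \<epsilon>) (\<mu> \<epsilon>)"
    and "\<forall>\<epsilon>\<in>{0<..1}. 0 < a \<epsilon>"
    and "filterlim a at_top (at_right 0)"
    and "\<forall>t>0.
           0 < Liminf (at_right 0) (\<lambda>\<epsilon>. ereal (tv_to M (X \<epsilon> x) (\<mu> \<epsilon>) (a \<epsilon> * t))) \<and>
           Liminf (at_right 0) (\<lambda>\<epsilon>. ereal (tv_to M (X \<epsilon> x) (\<mu> \<epsilon>) (a \<epsilon> * t)))
             \<le> Limsup (at_right 0) (\<lambda>\<epsilon>. ereal (tv_to M (X \<epsilon> x) (\<mu> \<epsilon>) (a \<epsilon> * t))) \<and>
           Limsup (at_right 0) (\<lambda>\<epsilon>. ereal (tv_to M (X \<epsilon> x) (\<mu> \<epsilon>) (a \<epsilon> * t))) < 1"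
  shows "\<not> cutoff M (\<lambda>\<epsilon>. X \<epsilon> x) \<mu> \<and>
    (\<forall>G::real \<Rightarrow> real.
       (\<forall>t>0. G t \<in> {0<..<1} \<and>
          ((\<lambda>\<epsilon>. tv_to M (X \<epsilon> x) (\<mu> \<epsilon>) (a \<epsilon> * t)) \<longlongrightarrow> G t) (at_right 0)) \<and>
       continuous_on {0<..} G \<and> strict_antimono_on {0<..} G \<longrightarrow>
       (\<forall>\<eta>\<in>{0<..<1}.
          ((\<lambda>\<epsilon>. mixing_time (tv_to M (X \<epsilon> x) (\<mu> \<epsilon>)) \<eta> / ereal (a \<epsilon>))
             \<longlongrightarrow> Inf {ereal t | t. 0 < t \<and> G t \<le> \<eta>}) (at_right 0)))"
proof (intro conjI allI impI ballI)
  let ?d = "\<lambda>\<epsilon>. tv_to M (X \<epsilon> x) (\<mu> \<epsilon>)"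
  have ev: "\<forall>\<^sub>F \<epsilon> in at_right 0. \<epsilon> \<in> {0<..1::real}"
    by (rule eventually_at_rightI[of 0 1]) auto
  \<comment> \<open>Convexity makes \<open>deriv V\<close> nondecreasing, so each fixed
    \<open>\<epsilon>\<close> is an instance of the monotone equation with noise coefficient
    \<open>sqrt \<epsilon>\<close>.\<close>
  have "?d \<epsilon> t \<le> ?d \<epsilon> s" if \<epsilon>: "\<epsilon> \<in> {0<..1}" and "0 \<le> s" "s \<le> t" for \<epsilon> s t
  proof -
    interpret monotone_sde M "deriv V" B "sqrt \<epsilon>" "X \<epsilon>"
      using assms(2,3,13,14) \<epsilon>
      by (intro monotone_sde_strong_solution monotone_function_deriv_convex) auto
    show ?thesis
      using assms(15) that by (intro tv_to_antimono) auto
  qed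
  with ev have anti: "\<forall>\<^sub>F \<epsilon> in at_right 0. \<forall>s t. 0 \<le> s \<longrightarrow> s \<le> t \<longrightarrow> ?d \<epsilon> t \<le> ?d \<epsilon> s"
    by (auto elim: eventually_mono)
  have a: "\<forall>\<^sub>F \<epsilon> in at_right 0. 0 < a \<epsilon>"
    using ev assms(16) by (auto elim: eventually_mono)
  show "\<not> cutoff M (\<lambda>\<epsilon>. X \<epsilon> x) \<mu>"
  proof
    assume "cutoff M (\<lambda>\<epsilon>. X \<epsilon> x) \<mu>"
    then obtain T where T: "\<forall>\<epsilon>\<in>{0<..1}. 0 < T \<epsilon>"
      and before: "\<forall>\<delta>\<in>{0<..<1}. ((\<lambda>\<epsilon>. ?d \<epsilon> (\<delta> * T \<epsilon>)) \<longlongrightarrow> 1) (at_right 0)"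
      and after: "\<forall>\<delta>\<in>{1<..}. ((\<lambda>\<epsilon>. ?d \<epsilon> (\<delta> * T \<epsilon>)) \<longlongrightarrow> 0) (at_right 0)"
      unfolding cutoff_def by blast
    show False
    proof (rule no_common_cutoff_scale[where d = ?d and a = a and T = T and F = "at_right 0"])
      show "\<forall>\<^sub>F \<epsilon> in at_right 0. 0 < T \<epsilon>"
        using ev T by (auto elim: eventually_mono)
      show "0 < Liminf (at_right 0) (\<lambda>\<epsilon>. ereal (?d \<epsilon> (a \<epsilon> * 4)))"
        using assms(18) by (meson zero_less_numeral)
      show "Limsup (at_right 0) (\<lambda>\<epsilon>. ereal (?d \<epsilon> (a \<epsilon> * 1))) < 1"
        using assms(18) by (meson zero_less_one)
      show "((\<lambda>\<epsilon>. ?d \<epsilon> (1/2 * T \<epsilon>)) \<longlongrightarrow> 1) (at_right 0)"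
        using before by (rule bspec) simp
      show "((\<lambda>\<epsilon>. ?d \<epsilon> (2 * T \<epsilon>)) \<longlongrightarrow> 0) (at_right 0)"
        using after by (rule bspec) simp
    qed (use anti a in auto)
  qed
  fix G :: "real \<Rightarrow> real" and \<eta> :: real
  assume G: "(\<forall>t>0. G t \<in> {0<..<1} \<and> ((\<lambda>\<epsilon>. ?d \<epsilon> (a \<epsilon> * t)) \<longlongrightarrow> G t) (at_right 0)) \<and>
       continuous_on {0<..} G \<and> strict_antimono_on {0<..} G"
  show "((\<lambda>\<epsilon>. mixing_time (?d \<epsilon>) \<eta> / ereal (a \<epsilon>)) \<longlongrightarrow> Inf {ereal t | t. 0 < t \<and> G t \<le> \<eta>}) (at_right 0)"
    using G by (intro scaled_mixing_time_tendsto[OF anti a]) blast+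
qed

end
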